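(* Let $\Gamma$ be a countably infinite discrete amenable group and let $\mathsf{A}$ be a nonempty finite subset of $\Gamma$. Then $$h_{\mathrm{top}}(X_{\mathsf{A}})\ge\log\frac{|\mathsf{A}|}{e},$$ where $e=2.71828\dots$ is the Euler number. Furthermore, the following are equivalent: (1) $h_{\mathrm{top}}(X_{\mathsf{A}})=0$; (2) $|\mathsf{A}|=1$, or $|\mathsf{A}|=2$ with $\mathsf{A}=\{s,t\}$ such that $st^{-1}$ has infinite order.
   Context: $X_{\mathsf{A}}$ is the set of all $x=(x_s)_{s\in\Gamma}\in\mathsf{A}^\Gamma$ such that the map $\Gamma\to\Gamma$, $s\mapsto sx_s$, is bijective. It is a closed subset of $\mathsf{A}^\Gamma$ (product topology), invariant under the left shift action $(\lambda^sx)_t=x_{s^{-1}t}$ of $\Gamma$. $h_{\mathrm{top}}(X_{\mathsf{A}})$ is the topological entropy of this action on $X_{\mathsf{A}}$; it equals $\lim_F\frac1{|F|}\log|\pi_F(X_{\mathsf{A}})|$, where $\pi_F$ is restriction of coordinates to the nonempty finite set $F\subset\Gamma$ and the limit is taken as $F$ becomes more and more right invariant (i.e. $\lim_F\phi(F)=C$ means: for every neighbourhood $U$ of $C$ there are a nonempty finite $K\subset\Gamma$ and $\delta>0$ with $\phi(F)\in U$ whenever $|FK\vartriangle F|<\delta|F|$). *)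

theory Defs
  imports
    "HOL-Analysis.Function_Topology"
    "HOL-Library.Extended_Real"
    "HOL-Algebra.Multiplicative_Group"
begin

definition right_invariant_sets ::
    "('g, 'm) monoid_scheme \<Rightarrow> 'g set \<Rightarrow> real \<Rightarrow> 'g set set" where
  "right_invariant_sets G K \<delta> =
     {F. finite F \<and> F \<noteq> {} \<and> F \<subseteq> carrier G \<and>
         real (card (sym_diff (F <#>\<^bsub>G\<^esub> K) F)) < \<delta> * real (card F)}"

text \<open>
  The filter of nonempty finite sets becoming more and more right invariant;
  see \<open>eventually_right_invariant\<close> and \<open>tendsto_right_invariant_iff\<close> below.
\<close>

definition right_invariant :: "('g, 'm) monoid_scheme \<Rightarrow> 'g set filter" where
  "right_invariant G =
     (INF (K, \<delta>) \<in> {(K, \<delta>). finite K \<and> K \<noteq> {} \<and> K \<subseteq> carrier G \<and> 0 < \<delta>}.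
        principal (right_invariant_sets G K \<delta>))"

text \<open>Amenability of a discrete group, in the form of the F\o lner condition.\<close>

definition amenable :: "('g, 'm) monoid_scheme \<Rightarrow> bool" where
  "amenable G \<longleftrightarrow>
     (\<forall>K \<delta>. finite K \<and> K \<noteq> {} \<and> K \<subseteq> carrier G \<and> 0 < \<delta> \<longrightarrow> right_invariant_sets G K \<delta> \<noteq> {})"

definition finite_open_cover :: "'x topology \<Rightarrow> 'x set set \<Rightarrow> bool" where
  "finite_open_cover X \<U> \<longleftrightarrow> finite \<U> \<and> (\<forall>U\<in>\<U>. openin X U) \<and> \<Union>\<U> = topspace X"

definition min_subcover_card :: "'x topology \<Rightarrow> 'x set set \<Rightarrow> nat" where
  "min_subcover_card X \<U> = (LEAST n. \<exists>\<V>\<subseteq>\<U>. finite \<V> \<and> card \<V> = n \<and> \<Union>\<V> = topspace X)"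

text \<open>
  The join of the covers \<open>{\<alpha> s ` U | U \<in> \<U>}\<close> over \<open>s \<in> F\<close>. Translating by \<open>s\<close> (and not by
  its inverse) is the convention that goes with right invariance of \<open>F\<close>.
\<close>

definition translated_join :: "('g \<Rightarrow> 'x \<Rightarrow> 'x) \<Rightarrow> 'g set \<Rightarrow> 'x set set \<Rightarrow> 'x set set" where
  "translated_join \<alpha> F \<U> = {\<Inter>s\<in>F. \<alpha> s ` u s | u. u \<in> F \<rightarrow> \<U>}"

text \<open>
  Topological entropy of a continuous action \<open>\<alpha>\<close> of an amenable group \<open>G\<close> on a compact space
  \<open>X\<close>: the supremum, over all finite open covers \<open>\<U>\<close>, of \<open>lim\<^sub>F log N(\<U>\<^sup>F) / |F|\<close>.
  By the Ornstein-Weiss lemma this limit exists for every finite open cover.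
\<close>

definition topological_entropy ::
    "('g, 'm) monoid_scheme \<Rightarrow> ('g \<Rightarrow> 'x \<Rightarrow> 'x) \<Rightarrow> 'x topology \<Rightarrow> ereal" where
  "topological_entropy G \<alpha> X =
     Sup {ereal l | l \<U>. finite_open_cover X \<U> \<and>
       ((\<lambda>F. ln (real (min_subcover_card X (translated_join \<alpha> F \<U>))) / real (card F))
          \<longlongrightarrow> l) (right_invariant G)}"

text \<open>
  A configuration \<open>x \<in> A\<^sup>\<Gamma>\<close>, rendered as an extensional function on the carrier, encodes the
  permutation \<open>s \<mapsto> s x\<^sub>s\<close> of the group.
\<close>

definition restricted_permutations :: "('g, 'm) monoid_scheme \<Rightarrow> 'g set \<Rightarrow> ('g \<Rightarrow> 'g) set" where
  "restricted_permutations G A =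
     {x \<in> carrier G \<rightarrow>\<^sub>E A. bij_betw (\<lambda>s. s \<otimes>\<^bsub>G\<^esub> x s) (carrier G) (carrier G)}"

definition restricted_permutations_space ::
    "('g, 'm) monoid_scheme \<Rightarrow> 'g set \<Rightarrow> ('g \<Rightarrow> 'g) topology" where
  "restricted_permutations_space G A =
     subtopology (product_topology (\<lambda>_. discrete_topology A) (carrier G))
       (restricted_permutations G A)"

definition left_shift :: "('g, 'm) monoid_scheme \<Rightarrow> 'g \<Rightarrow> ('g \<Rightarrow> 'a) \<Rightarrow> ('g \<Rightarrow> 'a)" where
  "left_shift G s x = (\<lambda>t\<in>carrier G. x (inv\<^bsub>G\<^esub> s \<otimes>\<^bsub>G\<^esub> t))"

definition h_top :: "('g, 'm) monoid_scheme \<Rightarrow> 'g set \<Rightarrow> ereal" where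
  "h_top G A = topological_entropy G (left_shift G) (restricted_permutations_space G A)"

lemma finite_set_mult: "finite F \<Longrightarrow> finite K \<Longrightarrow> finite (F <#>\<^bsub>G\<^esub> K)"
  by (simp add: set_mult_def)

lemma card_sym_diff_set_mult_le:
  assumes "group G" "finite F" "finite K" "K \<noteq> {}" "F \<subseteq> carrier G" "K \<subseteq> carrier G"
    and "finite M" "K \<subseteq> M"
  shows "card (sym_diff (F <#>\<^bsub>G\<^esub> K) F) \<le> 2 * card (sym_diff (F <#>\<^bsub>G\<^esub> M) F)"
proof -
  interpret group G by fact
  obtain k where k: "k \<in> K" "k \<in> carrier G" using assms by blast
  have "card F = card ((\<lambda>f. f \<otimes>\<^bsub>G\<^esub> k) ` F)"
    using k assms(5) by (intro card_image [symmetric] inj_onI) (metis right_cancel subsetD)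
  also have "\<dots> \<le> card (F <#>\<^bsub>G\<^esub> K)"
    using k assms by (intro card_mono finite_set_mult) (auto simp: set_mult_def)
  finally have le: "card F \<le> card (F <#>\<^bsub>G\<^esub> K)" .
  have fin: "finite (F <#>\<^bsub>G\<^esub> K)" "finite (F <#>\<^bsub>G\<^esub> M)"
    using assms by (auto intro: finite_set_mult)
  have "card (F - (F <#>\<^bsub>G\<^esub> K)) \<le> card ((F <#>\<^bsub>G\<^esub> K) - F)"
    using le fin \<open>finite F\<close> by (simp add: card_le_sym_Diff)
  moreover have "card (sym_diff (F <#>\<^bsub>G\<^esub> K) F) = card ((F <#>\<^bsub>G\<^esub> K) - F) + card (F - (F <#>\<^bsub>G\<^esub> K))"
    using fin \<open>finite F\<close> by (intro card_Un_disjoint) auto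
  moreover have "card ((F <#>\<^bsub>G\<^esub> K) - F) \<le> card (sym_diff (F <#>\<^bsub>G\<^esub> M) F)"
    using fin \<open>finite F\<close> \<open>K \<subseteq> M\<close> by (intro card_mono) (simp, unfold set_mult_def, blast)
  ultimately show ?thesis by linarith
qed

lemma right_invariant_sets_mono:
  assumes "group G" "finite K" "K \<noteq> {}" "K \<subseteq> carrier G" "finite M" "K \<subseteq> M" "\<epsilon> \<le> \<delta> / 2"
  shows "right_invariant_sets G M \<epsilon> \<subseteq> right_invariant_sets G K \<delta>"
proof
  fix F assume F: "F \<in> right_invariant_sets G M \<epsilon>"
  then have "card (sym_diff (F <#>\<^bsub>G\<^esub> K) F) \<le> 2 * card (sym_diff (F <#>\<^bsub>G\<^esub> M) F)"
    using assms by (intro card_sym_diff_set_mult_le) (auto simp: right_invariant_sets_def)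
  moreover have "real (card (sym_diff (F <#>\<^bsub>G\<^esub> M) F)) < \<epsilon> * real (card F)"
    using F by (simp add: right_invariant_sets_def)
  moreover have "\<epsilon> * real (card F) \<le> \<delta> / 2 * real (card F)"
    using assms by (intro mult_right_mono) auto
  ultimately have "real (card (sym_diff (F <#>\<^bsub>G\<^esub> K) F)) < \<delta> * real (card F)"
    by linarith
  then show "F \<in> right_invariant_sets G K \<delta>"
    using F by (simp add: right_invariant_sets_def)
qed

lemma eventually_right_invariant:
  assumes "group G"
  shows "eventually P (right_invariant G) \<longleftrightarrow>
    (\<exists>K \<delta>. finite K \<and> K \<noteq> {} \<and> K \<subseteq> carrier G \<and> 0 < \<delta> \<and>
      (\<forall>F\<in>right_invariant_sets G K \<delta>. P F))"
proof -
  interpret group G by fact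
  let ?I = "{(K, \<delta>::real). finite K \<and> K \<noteq> {} \<and> K \<subseteq> carrier G \<and> 0 < \<delta>}"
  let ?S = "\<lambda>(K, \<delta>). principal (right_invariant_sets G K \<delta>)"
  have "({\<one>\<^bsub>G\<^esub>}, 1) \<in> ?I" by simp
  then have ne: "?I \<noteq> {}" by blast
  have dir: "\<exists>x\<in>?I. ?S x \<le> inf (?S a) (?S b)" if ab: "a \<in> ?I" "b \<in> ?I" for a b
  proof -
    obtain K \<delta> L \<epsilon> where eq: "a = (K, \<delta>)" "b = (L, \<epsilon>)" by (cases a, cases b)
    have *: "right_invariant_sets G (K \<union> L) (min \<delta> \<epsilon> / 2)
            \<subseteq> right_invariant_sets G K \<delta> \<inter> right_invariant_sets G L \<epsilon>"
      using ab assms unfolding eq by (intro Int_greatest right_invariant_sets_mono) auto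
    show ?thesis
      using ab * unfolding eq
      by (intro bexI [of _ "(K \<union> L, min \<delta> \<epsilon> / 2)"]) (simp_all add: inf_principal)
  qed
  show ?thesis
    unfolding right_invariant_def
    by (subst eventually_INF_base [OF ne dir])
      (simp_all add: eventually_principal split_beta conj_assoc Bex_def)
qed

lemma tendsto_right_invariant_iff:
  assumes "group G"
  shows "(\<phi> \<longlongrightarrow> C) (right_invariant G) \<longleftrightarrow>
    (\<forall>U. open U \<and> C \<in> U \<longrightarrow>
      (\<exists>K \<delta>. finite K \<and> K \<noteq> {} \<and> K \<subseteq> carrier G \<and> 0 < \<delta> \<and>
        (\<forall>F\<in>right_invariant_sets G K \<delta>. \<phi> F \<in> U)))"
  unfolding tendsto_def eventually_right_invariant [OF assms] imp_conjL ..

lemma amenable_iff_right_invariant_nontrivial: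
  assumes "group G"
  shows "amenable G \<longleftrightarrow> right_invariant G \<noteq> bot"
  unfolding trivial_limit_def eventually_right_invariant [OF assms]
    amenable_def
  by (simp only: ball_simps not_ex de_Morgan_conj imp_conv_disj Ball_def
      ex_in_conv [symmetric]) blast

lemma topspace_restricted_permutations_space:
  "topspace (restricted_permutations_space G A) = restricted_permutations G A"
  by (auto simp: restricted_permutations_space_def restricted_permutations_def)

end

theory Submission
  imports
    Defs
    "HOL-Analysis.Complex_Transcendental"
begin

text \<open>
  Write \<open>N E\<close> for the number of patterns of \<open>X\<^sub>A\<close> on a finite set \<open>E\<close>. Shearer's inequality shows that
  \<open>log (N F) / |F|\<close> converges to the infimum \<open>h\<close> of \<open>log (N E) / |E|\<close> over all finite \<open>E\<close>, and
  compactness identifies \<open>h\<close> with the topological entropy.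

  For \<open>h \<ge> log (|A| / e)\<close>, fix \<open>E\<close>. By compactness, a configuration that is injective on a
  sufficiently large finite \<open>M\<close>, and hits every point that can only be hit from \<open>M\<close>, restricts on \<open>E\<close> to
  a pattern of \<open>X\<^sub>A\<close>. On a very invariant \<open>F\<close> such configurations are counted by the permanent of
  an \<open>F \<times> F\<close> matrix which is \<open>|A|\<close> times a doubly stochastic one, and the permanent of a
  doubly stochastic \<open>n \<times> n\<close> matrix is at least \<open>exp (-n)\<close>. Shearer's inequality applied to the
  translates of \<open>E\<close> inside \<open>F\<close> turns this count into a lower bound for \<open>N E\<close>.

  Since \<open>e < 3\<close>, entropy \<open>0\<close> forces \<open>|A| \<le> 2\<close>. If \<open>A = {a, b}\<close>, the elements of \<open>X\<^sub>A\<close> are exactly the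
  functions that are constant on the left cosets of the subgroup generated by \<open>a b\<^sup>-\<^sup>1\<close>.
\<close>

subsection \<open>Shearer's inequality\<close>

text \<open>Shearer's inequality needs no disjoint tiles: translates \<open>gE\<close> may overlap
  freely, as long as each point lies in exactly \<open>card E\<close> of them. It is applied to two
  families: to true patterns on \<open>F\<close>, with every translate that meets \<open>F\<close>,
  and to the patterns read off from bijections of \<open>F\<close>, with translates deep inside
  \<open>F\<close>. The second use answers an obstacle: a bijection of a finite set that moves
  points by letters of \<open>A\<close> need not extend to an element of \<open>X\<close>. Only its
  windows far from the boundary are known to be patterns of \<open>X\<close>, so the count has to
  pass from \<open>F\<close> to windows without asking for an extension from \<open>F\<close>
  itself. The constant e comes from the capacity argument. If p(\<tau>) is at least C \<tau> and at
  most p(0) exp(\<tau> p'(0) / p(0)) for positive \<tau>, then \<tau> = p(0) / p'(0) gives p'(0)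
  \<ge> C / e, and this is repeated once per row. The exponential bound takes the place of
  real-rootedness; it rests on negative correlation of the events that targets stay unmatched in a
  weighted random matching.\<close>

lemma prod_le_mean_power:
  fixes x :: "'i \<Rightarrow> real"
  assumes "finite J" "J \<noteq> {}" and x: "\<And>i. i \<in> J \<Longrightarrow> 0 \<le> x i"
  shows "(\<Prod>i\<in>J. x i) \<le> (\<Sum>i\<in>J. x i / card J) ^ card J"
proof -
  have k: "card J > 0" using assms by (simp add: card_gt_0_iff)
  have p: "0 \<le> (\<Prod>i\<in>J. x i)" using x by (intro prod_nonneg) auto
  have "(\<Prod>i\<in>J. x i) = ((\<Prod>i\<in>J. x i) powr (1 / card J)) ^ card J"
  proof (cases "(\<Prod>i\<in>J. x i) = 0")
    case True then show ?thesis using k by simp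
  next
    case False
    then have "(\<Prod>i\<in>J. x i) > 0" using p by linarith
    then show ?thesis using k by (simp add: powr_powr flip: powr_realpow)
  qed
  also have "\<dots> \<le> (\<Sum>i\<in>J. x i / card J) ^ card J"
    using arith_geom_mean[OF assms] by (intro power_mono) auto
  finally show ?thesis .
qed

text \<open>Hoelder's inequality for \<open>card J\<close> functions with equal exponents, stated
  with powers so that no roots appear. After normalising each \<open>n i\<close> by its sum, the
  arithmetic-geometric mean bounds \<open>z a\<close> by \<open>R * m a\<close>, where the
  \<open>m a\<close> add up to 1.\<close>

lemma sum_power_le_prod_sum:
  fixes z :: "'a \<Rightarrow> real" and n :: "'i \<Rightarrow> 'a \<Rightarrow> real"
  assumes "finite A" "finite J" "J \<noteq> {}" "0 \<le> c"
    and z: "\<And>a. a \<in> A \<Longrightarrow> 0 \<le> z a"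
    and n: "\<And>i a. i \<in> J \<Longrightarrow> a \<in> A \<Longrightarrow> 0 \<le> n i a"
    and le: "\<And>a. a \<in> A \<Longrightarrow> z a ^ card J \<le> c * (\<Prod>i\<in>J. n i a)"
  shows "(\<Sum>a\<in>A. z a) ^ card J \<le> c * (\<Prod>i\<in>J. \<Sum>a\<in>A. n i a)"
proof -
  define k where "k = card J"
  define N where "N i = (\<Sum>a\<in>A. n i a)" for i
  have k: "k > 0" using assms by (simp add: card_gt_0_iff k_def)
  have N0: "0 \<le> N i" if "i \<in> J" for i using that n by (auto simp: N_def intro: sum_nonneg)
  show ?thesis
  proof (cases "\<exists>i\<in>J. N i = 0")
    \<comment> \<open>A vanishing sum cannot be normalised; it forces every \<open>z a\<close> to be
      0.\<close>
    case True
    then obtain i where i: "i \<in> J" "N i = 0" by auto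
    then have "n i a = 0" if "a \<in> A" for a
      using that n \<open>finite A\<close> by (auto simp: N_def sum_nonneg_eq_0_iff)
    then have "(\<Prod>i\<in>J. n i a) = 0" if "a \<in> A" for a
      using that i \<open>finite J\<close> by auto
    then have "z a ^ k \<le> 0" if "a \<in> A" for a using le that by (fastforce simp: k_def)
    then have "z a = 0" if "a \<in> A" for a
      using that z k by (metis order_antisym power_eq_0_iff zero_le_power)
    then show ?thesis
      using k N0 \<open>0 \<le> c\<close> by (simp add: k_def N_def prod_nonneg zero_power)
  next
    case False
    then have N: "0 < N i" if "i \<in> J" for i using that N0 by force
    define C where "C = c * (\<Prod>i\<in>J. N i)"
    define R where "R = root k C"
    have "C \<ge> 0" using N0 \<open>0 \<le> c\<close> by (simp add: C_def prod_nonneg)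
    then have R: "R ^ k = C" "R \<ge> 0" using k by (simp_all add: R_def)
    define m where "m a = (\<Sum>i\<in>J. (n i a / N i) / card J)" for a
    have m0: "m a \<ge> 0" if "a \<in> A" for a
      using that n N0 by (auto simp: m_def intro!: sum_nonneg)
    have "z a \<le> R * m a" if a: "a \<in> A" for a
    proof -
      have "(\<Prod>i\<in>J. n i a) = (\<Prod>i\<in>J. N i * (n i a / N i))"
        using N by (intro prod.cong) (auto dest: N)
      then have "z a ^ k \<le> c * (\<Prod>i\<in>J. N i * (n i a / N i))"
        using le[OF a] by (simp only: k_def)
      also have "\<dots> = C * (\<Prod>i\<in>J. n i a / N i)" by (simp only: C_def prod.distrib mult.assoc)
      also have "\<dots> \<le> C * m a ^ k"
        unfolding m_def k_def using \<open>C \<ge> 0\<close> assms(2,3) N0 n a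
        by (intro mult_left_mono prod_le_mean_power) auto
      also have "\<dots> = (R * m a) ^ k" by (simp add: power_mult_distrib R)
      finally show ?thesis
        using k m0[OF a] R(2) z[OF a] power_mono_iff[of "z a" "R * m a" k] by simp
    qed
    then have "(\<Sum>a\<in>A. z a) \<le> (\<Sum>a\<in>A. R * m a)" by (intro sum_mono)
    also have "\<dots> = R * (\<Sum>i\<in>J. \<Sum>a\<in>A. (n i a / N i) / card J)"
      unfolding m_def sum_distrib_left[symmetric] by (subst sum.swap) simp
    also have "\<dots> = R * (\<Sum>i\<in>J. 1 / card J)"
      using N by (intro arg_cong[where f="(*) R"] sum.cong)
        (auto simp: sum_divide_distrib[symmetric] N_def[symmetric] less_imp_neq[symmetric] dest!: N)
    also have "\<dots> = R" using k by (simp add: k_def)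
    finally have "(\<Sum>a\<in>A. z a) ^ k \<le> R ^ k" using z by (intro power_mono sum_nonneg) auto
    then show ?thesis unfolding R(1) by (simp only: C_def N_def k_def)
  qed
qed

lemma card_eq_sum_fibres:
  assumes "finite Y" "finite A" "\<And>y. y \<in> Y \<Longrightarrow> h y \<in> A"
  shows "card Y = (\<Sum>a\<in>A. card {y\<in>Y. h y = a})"
proof -
  have "Y = (\<Union>a\<in>A. {y\<in>Y. h y = a})" using assms by auto
  then have "card Y = card (\<Union>a\<in>A. {y\<in>Y. h y = a})" by simp
  also have "\<dots> = (\<Sum>a\<in>A. card {y\<in>Y. h y = a})"
    using assms by (intro card_UN_disjoint) auto
  finally show ?thesis .
qed

text \<open>Induction on \<open>F\<close>, splitting \<open>Y\<close> by the value at the new point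
  \<open>f\<close>. A window that misses \<open>f\<close> is bounded by \<open>card (W i)\<close> in
  every fibre; for the \<open>k\<close> windows that contain \<open>f\<close>, the fibre counts add
  up to at most \<open>card (W i)\<close>, and \<open>sum_power_le_prod_sum\<close> combines these
  \<open>k\<close> sums.\<close>

lemma shearer:
  fixes Y :: "('f \<Rightarrow> 'a) set" and S :: "'i \<Rightarrow> 'f set"
  assumes "finite F" "finite I" "finite A" "0 < k" "Y \<subseteq> F \<rightarrow>\<^sub>E A"
    and "\<And>f. f \<in> F \<Longrightarrow> card {i\<in>I. f \<in> S i} = k"
  shows "card Y ^ k \<le> (\<Prod>i\<in>I. card ((\<lambda>y. restrict y (S i \<inter> F)) ` Y))"
  using assms(1,5,6)
proof (induction F arbitrary: Y rule: finite_induct)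
  case empty
  show ?case
  proof (cases "Y = {}")
    case False
    then have Y: "Y = {\<lambda>_. undefined}" using empty.prems(1) by auto
    show ?thesis by (simp add: Y)
  qed (use \<open>0 < k\<close> in \<open>simp add: zero_power\<close>)
next
  case (insert f F)
  have finY: "finite Y"
    using insert.prems(1) insert.hyps \<open>finite A\<close> by (meson finite.insertI finite_PiE finite_subset)
  define W where "W i = (\<lambda>y. restrict y (S i \<inter> insert f F)) ` Y" for i
  define Ya where "Ya a = {y\<in>Y. y f = a}" for a
  define Z where "Z a = (\<lambda>y. restrict y F) ` Ya a" for a
  define n where "n i a = card ((\<lambda>y. restrict y (S i \<inter> F)) ` Z a)" for i a
  define J where "J = {i\<in>I. f \<in> S i}"
  have J: "card J = k" "finite J" "J \<subseteq> I" using insert.prems(2)[of f] \<open>finite I\<close> by (auto simp: J_def)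
  then have "J \<noteq> {}" using \<open>0 < k\<close> by auto
  have "inj_on (\<lambda>y. restrict y F) (Ya a)" for a
  proof (rule inj_onI)
    fix y y' assume yy: "y \<in> Ya a" "y' \<in> Ya a" "restrict y F = restrict y' F"
    then have "y \<in> insert f F \<rightarrow>\<^sub>E A" "y' \<in> insert f F \<rightarrow>\<^sub>E A"
      using insert.prems(1) by (auto simp: Ya_def)
    moreover have "y t = y' t" if "t \<in> insert f F" for t
      using yy that by (auto simp: Ya_def restrict_def dest: fun_cong[where x = t])
    ultimately show "y = y'" by (rule PiE_ext)
  qed
  then have cardZ: "card (Z a) = card (Ya a)" for a unfolding Z_def by (rule card_image)
  have Zsub: "Z a \<subseteq> F \<rightarrow>\<^sub>E A" for a
    using insert.prems(1) by (auto simp: Z_def Ya_def PiE_def Pi_def)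
  have IH: "card (Z a) ^ k \<le> (\<Prod>i\<in>I. n i a)" for a
    unfolding n_def using insert.prems(2) by (intro insert.IH Zsub) auto
  \<comment> \<open>The implication covers both kinds of windows: it is vacuous when
    \<open>S i\<close> misses \<open>f\<close>.\<close>
  have nW: "n i a \<le> card {w \<in> W i. f \<in> S i \<longrightarrow> w f = a}" for i a
  proof -
    have "(\<lambda>y. restrict y (S i \<inter> F)) ` Z a
      \<subseteq> (\<lambda>w. restrict w (S i \<inter> F)) ` {w \<in> W i. f \<in> S i \<longrightarrow> w f = a}"
    proof
      fix w assume "w \<in> (\<lambda>y. restrict y (S i \<inter> F)) ` Z a"
      then obtain y where y: "y \<in> Y" "y f = a" "w = restrict (restrict y F) (S i \<inter> F)"
        by (auto simp: Z_def Ya_def)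
      then have "w = restrict (restrict y (S i \<inter> insert f F)) (S i \<inter> F)"
        by (auto simp: restrict_def)
      moreover have "restrict y (S i \<inter> insert f F) \<in> {w \<in> W i. f \<in> S i \<longrightarrow> w f = a}"
        using y(1,2) by (auto simp: W_def)
      ultimately show "w \<in> (\<lambda>w. restrict w (S i \<inter> F)) ` {w \<in> W i. f \<in> S i \<longrightarrow> w f = a}"
        by (rule image_eqI)
    qed
    then show ?thesis
      unfolding n_def by (rule surj_card_le[rotated]) (use finY in \<open>auto simp: W_def\<close>)
  qed
  have finW: "finite (W i)" for i using finY by (simp add: W_def)
  have nW1: "n i a \<le> card (W i)" for i a
    using finW by (intro order_trans[OF nW] card_mono) auto
  have nW2: "(\<Sum>a\<in>A. n i a) \<le> card (W i)" if "i \<in> J" for i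
  proof -
    have fi: "f \<in> S i" using that by (simp add: J_def)
    have "(\<Sum>a\<in>A. n i a) \<le> (\<Sum>a\<in>A. card {w \<in> W i. w f = a})"
      using nW[of i] fi by (intro sum_mono) auto
    also have "\<dots> = card (W i)"
    proof (rule card_eq_sum_fibres[symmetric, OF finW \<open>finite A\<close>])
      fix w assume "w \<in> W i"
      then obtain y where "y \<in> Y" "w f = y f" using fi by (auto simp: W_def)
      then show "w f \<in> A" using insert.prems(1) by auto
    qed
    finally show ?thesis .
  qed
  have "real (card (Ya a)) ^ card J \<le> (\<Prod>i\<in>I-J. real (card (W i))) * (\<Prod>i\<in>J. real (n i a))" for a
  proof -
    have "real (card (Ya a)) ^ card J \<le> (\<Prod>i\<in>I. real (n i a))"
      using IH[of a] by (simp add: J cardZ flip: of_nat_power of_nat_prod)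
    also have "\<dots> = (\<Prod>i\<in>I-J. real (n i a)) * (\<Prod>i\<in>J. real (n i a))"
      using J \<open>finite I\<close> by (simp add: prod.subset_diff)
    also have "\<dots> \<le> (\<Prod>i\<in>I-J. real (card (W i))) * (\<Prod>i\<in>J. real (n i a))"
      using nW1 by (intro mult_right_mono prod_mono prod_nonneg) auto
    finally show ?thesis .
  qed
  then have "(\<Sum>a\<in>A. real (card (Ya a))) ^ card J
      \<le> (\<Prod>i\<in>I-J. real (card (W i))) * (\<Prod>i\<in>J. \<Sum>a\<in>A. real (n i a))"
    using \<open>J \<noteq> {}\<close> J \<open>finite A\<close> by (intro sum_power_le_prod_sum) (auto intro: prod_nonneg)
  also have "\<dots> \<le> (\<Prod>i\<in>I-J. real (card (W i))) * (\<Prod>i\<in>J. real (card (W i)))"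
    using nW2 by (intro mult_left_mono prod_mono prod_nonneg) (auto simp flip: of_nat_sum)
  also have "\<dots> = (\<Prod>i\<in>I. real (card (W i)))"
    using J \<open>finite I\<close> by (simp add: prod.subset_diff)
  also have "(\<Sum>a\<in>A. real (card (Ya a))) = card Y"
  proof -
    have "y f \<in> A" if "y \<in> Y" for y using that insert.prems(1) by auto
    then show ?thesis
      using card_eq_sum_fibres[OF finY \<open>finite A\<close>, of "\<lambda>y. y f"] by (simp add: Ya_def)
  qed
  finally show ?case
    by (simp only: W_def J of_nat_le_iff flip: of_nat_power of_nat_prod)
qed

subsection \<open>Permanents of doubly stochastic matrices\<close>

text \<open>Extensional, so that a matching is determined by its values on \<open>S\<close> and
  there are finitely many of them for finite \<open>S\<close> and \<open>T\<close>.\<close>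

definition injections :: "'a set \<Rightarrow> 'b set \<Rightarrow> ('a \<Rightarrow> 'b) set" where
  "injections S T = {\<phi> \<in> S \<rightarrow>\<^sub>E T. inj_on \<phi> S}"

text \<open>The permanent of \<open>c\<close> when \<open>S\<close> and \<open>T\<close> are finite
  of equal size. For nonnegative \<open>c\<close> of positive total weight, the quotient
  \<open>matching_weight c S (T - U) / matching_weight c S T\<close> is the probability that a
  random matching, drawn with these weights, leaves all of \<open>U\<close> unmatched.\<close>

definition matching_weight :: "('a \<Rightarrow> 'b \<Rightarrow> real) \<Rightarrow> 'a set \<Rightarrow> 'b set \<Rightarrow> real" where
  "matching_weight c S T = (\<Sum>\<phi>\<in>injections S T. \<Prod>s\<in>S. c s (\<phi> s))"

lemma finite_injections: "finite S \<Longrightarrow> finite T \<Longrightarrow> finite (injections S T)"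
  by (auto simp: injections_def intro: finite_subset[OF _ finite_PiE[of S "\<lambda>_. T"]])

lemma matching_weight_nonneg:
  "(\<And>s t. 0 \<le> c s t) \<Longrightarrow> 0 \<le> matching_weight c S T"
  by (auto simp: matching_weight_def intro!: sum_nonneg prod_nonneg)

text \<open>
  The sources on the path \<open>i, s\<^sub>1, \<phi> s\<^sub>1, s\<^sub>2, \<phi> s\<^sub>2, \<dots>\<close> with \<open>\<psi> s\<^sub>1 = i\<close> and \<open>\<psi> s\<^sub>k\<^sub>+\<^sub>1 = \<phi> s\<^sub>k\<close>,
  alternating between the matchings \<open>\<psi>\<close> and \<open>\<phi>\<close>.
\<close>

inductive_set alternating_path :: "'a set \<Rightarrow> 'b \<Rightarrow> ('a \<Rightarrow> 'b) \<Rightarrow> ('a \<Rightarrow> 'b) \<Rightarrow> 'a set"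
  for S i \<phi> \<psi> where
  start: "s \<in> S \<Longrightarrow> \<psi> s = i \<Longrightarrow> s \<in> alternating_path S i \<phi> \<psi>"
| step: "s \<in> alternating_path S i \<phi> \<psi> \<Longrightarrow> s' \<in> S \<Longrightarrow> \<psi> s' = \<phi> s \<Longrightarrow> s' \<in> alternating_path S i \<phi> \<psi>"

definition swap_off_path :: "'a set \<Rightarrow> 'b \<Rightarrow> ('a \<Rightarrow> 'b) \<Rightarrow> ('a \<Rightarrow> 'b) \<Rightarrow> 'a \<Rightarrow> 'b" where
  "swap_off_path S i \<phi> \<psi> = (\<lambda>s\<in>S. if s \<in> alternating_path S i \<phi> \<psi> then \<phi> s else \<psi> s)"

definition swap_off_path' :: "'a set \<Rightarrow> 'b \<Rightarrow> ('a \<Rightarrow> 'b) \<Rightarrow> ('a \<Rightarrow> 'b) \<Rightarrow> 'a \<Rightarrow> 'b" where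
  "swap_off_path' S i \<phi> \<psi> = (\<lambda>s\<in>S. if s \<in> alternating_path S i \<phi> \<psi> then \<psi> s else \<phi> s)"

lemma alternating_path_subset: "s \<in> alternating_path S i \<phi> \<psi> \<Longrightarrow> s \<in> S"
  by (auto elim: alternating_path.cases)

context
  fixes S :: "'a set" and T U :: "'b set" and i :: 'b and \<phi> \<psi> :: "'a \<Rightarrow> 'b"
  assumes U: "i \<notin> U" and \<phi>: "\<phi> \<in> injections S (T - U - {i})" and \<psi>: "\<psi> \<in> injections S T"
begin

lemma path_target:
  assumes "s \<in> alternating_path S i \<phi> \<psi>"
  shows "\<psi> s = i \<or> (\<exists>s'\<in>alternating_path S i \<phi> \<psi>. \<psi> s = \<phi> s')"
  using assms by (cases rule: alternating_path.cases) auto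

lemma \<phi>_inj: "s \<in> S \<Longrightarrow> s' \<in> S \<Longrightarrow> \<phi> s = \<phi> s' \<Longrightarrow> s = s'"
  using \<phi> by (auto simp: injections_def inj_on_def)

lemma \<psi>_inj: "s \<in> S \<Longrightarrow> s' \<in> S \<Longrightarrow> \<psi> s = \<psi> s' \<Longrightarrow> s = s'"
  using \<psi> by (auto simp: injections_def inj_on_def)

lemma \<phi>_in: "s \<in> S \<Longrightarrow> \<phi> s \<in> T \<and> \<phi> s \<notin> U \<and> \<phi> s \<noteq> i"
  using \<phi> by (auto simp: injections_def)

lemma \<psi>_in: "s \<in> S \<Longrightarrow> \<psi> s \<in> T"
  using \<psi> by (auto simp: injections_def)

text \<open>A clash would need \<open>\<phi> s = \<psi> s'\<close> with \<open>s\<close> on the path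
  and \<open>s'\<close> off it, but then \<open>step\<close> puts \<open>s'\<close> on the path.
  Likewise \<open>start\<close> puts the source that \<psi> sends to \<open>i\<close> on the path,
  where \<phi> is used instead.\<close>

lemma swap_off_path_injections: "swap_off_path S i \<phi> \<psi> \<in> injections S (T - {i})"
proof -
  let ?C = "alternating_path S i \<phi> \<psi>"
  have ne: "\<phi> s \<noteq> \<psi> s'" if "s \<in> ?C" "s' \<in> S" "s' \<notin> ?C" for s s'
    using that alternating_path.step by metis
  have "inj_on (swap_off_path S i \<phi> \<psi>) S"
    using ne \<phi>_inj \<psi>_inj by (auto simp: inj_on_def swap_off_path_def) metis+
  moreover have "\<psi> s \<noteq> i" if "s \<in> S" "s \<notin> ?C" for s
    using that alternating_path.start by metis
  ultimately show ?thesis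
    using \<phi>_in \<psi>_in by (auto simp: injections_def swap_off_path_def)
qed

text \<open>On the path every value of \<psi> is \<open>i\<close> or a value of \<phi> at a path
  source. Hence it lies outside \<open>U\<close>, and it cannot be a value of \<phi> off the path,
  since \<phi> is injective and avoids \<open>i\<close>.\<close>

lemma swap_off_path'_injections: "swap_off_path' S i \<phi> \<psi> \<in> injections S (T - U)"
proof -
  let ?C = "alternating_path S i \<phi> \<psi>"
  have ne: "\<psi> s \<noteq> \<phi> s'" if "s \<in> ?C" "s' \<in> S" "s' \<notin> ?C" for s s'
    using that path_target[of s] \<phi>_in \<phi>_inj alternating_path_subset by metis
  have "inj_on (swap_off_path' S i \<phi> \<psi>) S"
    using ne \<phi>_inj \<psi>_inj by (auto simp: inj_on_def swap_off_path'_def) metis+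
  moreover have "\<psi> s \<notin> U" if "s \<in> ?C" for s
    using path_target[OF that] U \<phi>_in alternating_path_subset by metis
  ultimately show ?thesis
    using \<phi>_in \<psi>_in by (auto simp: injections_def swap_off_path'_def)
qed

text \<open>The swapped matchings agree with the original ones on the path, so it can be retraced.
  Off the path the second one is \<phi>, which avoids \<open>i\<close> and, being injective, repeats
  no value it takes on the path, so nothing new is reached. This makes the exchange an
  involution.\<close>

lemma alternating_path_swap:
  "alternating_path S i (swap_off_path S i \<phi> \<psi>) (swap_off_path' S i \<phi> \<psi>) = alternating_path S i \<phi> \<psi>"
    (is "?C' = ?C")
proof (intro equalityI subsetI)
  fix s assume "s \<in> ?C'"
  then show "s \<in> ?C"
  proof induction
    case (start s)
    then show ?case using \<phi>_in by (auto simp: swap_off_path'_def split: if_splits)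
  next
    case (step s s')
    have "s \<in> S" using step alternating_path_subset by metis
    show ?case
    proof (rule ccontr)
      assume "s' \<notin> ?C"
      then have "\<phi> s' = \<phi> s"
        using step \<open>s \<in> S\<close> by (simp add: swap_off_path'_def swap_off_path_def)
      then show False using \<phi>_inj[OF \<open>s' \<in> S\<close> \<open>s \<in> S\<close>] \<open>s' \<notin> ?C\<close> step by simp
    qed
  qed
next
  fix s assume "s \<in> ?C"
  then show "s \<in> ?C'"
  proof induction
    case (start s)
    then have "s \<in> ?C" by (rule alternating_path.start)
    then show ?case
      using start by (intro alternating_path.start) (auto simp: swap_off_path'_def)
  next
    case (step s s')
    then have "s' \<in> ?C" by (metis alternating_path.step)
    then show ?case
      using step alternating_path_subset[OF step(1)]
      by (intro alternating_path.step[of s, OF step.IH]) (auto simp: swap_off_path'_def swap_off_path_def)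
  qed
qed

lemma swap_off_path_inverse:
  defines "\<phi>' \<equiv> swap_off_path S i \<phi> \<psi>" and "\<psi>' \<equiv> swap_off_path' S i \<phi> \<psi>"
  shows "swap_off_path S i \<phi>' \<psi>' = \<phi>" "swap_off_path' S i \<phi>' \<psi>' = \<psi>"
proof -
  have ext: "\<phi> s = undefined" "\<psi> s = undefined" if "s \<notin> S" for s
    using that \<phi> \<psi> by (auto simp: injections_def PiE_def extensional_def)
  have "alternating_path S i \<phi>' \<psi>' = alternating_path S i \<phi> \<psi>"
    unfolding \<phi>'_def \<psi>'_def by (rule alternating_path_swap)
  then show "swap_off_path S i \<phi>' \<psi>' = \<phi>" "swap_off_path' S i \<phi>' \<psi>' = \<psi>"
    unfolding swap_off_path_def[of S i \<phi>' \<psi>'] swap_off_path'_def[of S i \<phi>' \<psi>']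
    by (auto simp: fun_eq_iff ext \<phi>'_def \<psi>'_def swap_off_path_def swap_off_path'_def)
qed

end

text \<open>
  Exchanging \<open>\<phi>\<close> and \<open>\<psi>\<close> off the alternating path of \<open>i\<close> moves the avoidance of \<open>U\<close> from \<open>\<phi>\<close> to \<open>\<psi>\<close> but
  leaves \<open>i\<close> with \<open>\<psi>\<close>, because the path never meets \<open>U\<close>; hence an injection of pairs of matchings.
\<close>

lemma matching_weight_correlation:
  assumes "finite S" "finite T" "i \<notin> U" and c: "\<And>s t. 0 \<le> c s t"
  shows "matching_weight c S (T - U - {i}) * matching_weight c S T
       \<le> matching_weight c S (T - {i}) * matching_weight c S (T - U)"
proof -
  let ?w = "\<lambda>\<phi>. \<Prod>s\<in>S. c s (\<phi> s)"
  let ?f = "\<lambda>(\<phi>, \<psi>). ?w \<phi> * ?w \<psi>"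
  let ?P = "injections S (T - U - {i}) \<times> injections S T"
  let ?Q = "injections S (T - {i}) \<times> injections S (T - U)"
  define h where "h = (\<lambda>(\<phi>, \<psi>). (swap_off_path S i \<phi> \<psi>, swap_off_path' S i \<phi> \<psi>))"
  have inv: "h (h p) = p" if "p \<in> ?P" for p
    using that swap_off_path_inverse[OF \<open>i \<notin> U\<close>] by (auto simp: h_def)
  have hQ: "h ` ?P \<subseteq> ?Q"
    using swap_off_path_injections[OF \<open>i \<notin> U\<close>] swap_off_path'_injections[OF \<open>i \<notin> U\<close>]
    by (auto simp: h_def)
  have fh: "?f (h p) = ?f p" for p
  proof (cases p)
    case (Pair \<phi> \<psi>)
    show ?thesis
      unfolding Pair h_def prod.case prod.distrib[symmetric]
      by (rule prod.cong) (auto simp: swap_off_path_def swap_off_path'_def)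
  qed
  have "matching_weight c S (T - U - {i}) * matching_weight c S T = (\<Sum>p\<in>?P. ?f p)"
    by (simp add: matching_weight_def sum_product sum.cartesian_product)
  also have "\<dots> = (\<Sum>p\<in>?P. ?f (h p))" by (simp only: fh)
  also have "\<dots> = sum ?f (h ` ?P)"
    by (subst sum.reindex) (auto intro: inj_on_inverseI[of _ h] inv)
  also have "\<dots> \<le> sum ?f ?Q"
    using hQ assms by (intro sum_mono2) (auto intro!: finite_injections mult_nonneg_nonneg prod_nonneg)
  also have "\<dots> = matching_weight c S (T - {i}) * matching_weight c S (T - U)"
    by (simp add: matching_weight_def sum_product sum.cartesian_product)
  finally show ?thesis .
qed

text \<open>Induction on \<open>U\<close>: each use of \<open>matching_weight_correlation\<close>
  splits off one target. In terms of the random matching, the probability that all of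
  \<open>U\<close> stays unmatched is at most the product of the single probabilities.\<close>

lemma matching_weight_diff_le:
  assumes "finite S" "finite T" "finite U" and c: "\<And>s t. 0 \<le> c s t"
    and pos: "0 < matching_weight c S T"
  shows "matching_weight c S (T - U)
    \<le> matching_weight c S T * (\<Prod>i\<in>U. matching_weight c S (T - {i}) / matching_weight c S T)"
  using \<open>finite U\<close>
proof induction
  case (insert i U)
  let ?W = "matching_weight c S"
  have "?W (T - insert i U) = ?W (T - U - {i})" by (rule arg_cong[OF Diff_insert])
  also have "\<dots> \<le> ?W (T - {i}) / ?W T * ?W (T - U)"
    using matching_weight_correlation[OF assms(1,2) insert(2) c] pos by (simp add: field_simps)
  also have "\<dots> \<le> ?W (T - {i}) / ?W T * (?W T * (\<Prod>i\<in>U. ?W (T - {i}) / ?W T))"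
    using insert.IH pos c by (intro mult_left_mono divide_nonneg_pos matching_weight_nonneg) auto
  finally show ?case using insert by (simp add: mult.left_commute)
qed simp

text \<open>Expanding the product over sets \<open>U\<close> of unmatched targets and applying
  negative correlation termwise bounds the mean by the product of \<open>1 + w t * q t\<close>,
  where \<open>q t\<close> is the probability that \<open>t\<close> stays unmatched. Linearity of
  the mean identifies the exponent.\<close>

lemma matching_weight_exp_bound:
  assumes "finite S" "finite T" and c: "\<And>s t. 0 \<le> c s t" and w: "\<And>t. 0 \<le> w t"
    and pos: "0 < matching_weight c S T"
  shows "(\<Sum>\<phi>\<in>injections S T. (\<Prod>s\<in>S. c s (\<phi> s)) * (\<Prod>t\<in>T - \<phi> ` S. 1 + w t))
    \<le> matching_weight c S T * exp ((\<Sum>\<phi>\<in>injections S T. (\<Prod>s\<in>S. c s (\<phi> s)) * (\<Sum>t\<in>T - \<phi> ` S. w t)) / matching_weight c S T)"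
proof -
  let ?W = "matching_weight c S" and ?p = "\<lambda>\<phi>. \<Prod>s\<in>S. c s (\<phi> s)"
  define q where "q i = ?W (T - {i}) / ?W T" for i
  have q0: "0 \<le> q i" for i
    unfolding q_def using pos c by (intro divide_nonneg_pos matching_weight_nonneg) auto
  have avoid: "{\<phi>\<in>injections S T. U \<subseteq> T - \<phi> ` S} = injections S (T - U)" if "U \<subseteq> T" for U
    using that by (auto simp: injections_def PiE_def Pi_def)
  \<comment> \<open>Used twice: with all subsets of \<open>T\<close> to expand the product, and with
    the singletons to recognise the sum of the \<open>w t * q t\<close>.\<close>
  have swap: "(\<Sum>\<phi>\<in>injections S T. ?p \<phi> * (\<Sum>U\<in>{U\<in>\<U>. U \<subseteq> T - \<phi> ` S}. g U))
      = (\<Sum>U\<in>\<U>. g U * ?W (T - U))" if "\<U> \<subseteq> Pow T" for \<U> and g :: "'b set \<Rightarrow> real"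
  proof -
    have fin: "finite \<U>" using that \<open>finite T\<close> by (meson finite_Pow_iff finite_subset)
    have "(\<Sum>\<phi>\<in>injections S T. ?p \<phi> * (\<Sum>U\<in>{U\<in>\<U>. U \<subseteq> T - \<phi> ` S}. g U))
      = (\<Sum>\<phi>\<in>injections S T. \<Sum>U\<in>{U\<in>\<U>. U \<subseteq> T - \<phi> ` S}. g U * ?p \<phi>)"
      by (simp add: sum_distrib_left mult.commute)
    also have "\<dots> = (\<Sum>U\<in>\<U>. \<Sum>\<phi>\<in>{\<phi>\<in>injections S T. U \<subseteq> T - \<phi> ` S}. g U * ?p \<phi>)"
      by (rule sum.swap_restrict) (use fin assms in \<open>auto intro: finite_injections\<close>)
    also have "\<dots> = (\<Sum>U\<in>\<U>. g U * ?W (T - U))"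
      using that by (intro sum.cong) (auto simp: avoid matching_weight_def sum_distrib_left)
    finally show ?thesis .
  qed
  have "(\<Sum>\<phi>\<in>injections S T. ?p \<phi> * (\<Prod>t\<in>T - \<phi> ` S. 1 + w t))
     = (\<Sum>\<phi>\<in>injections S T. ?p \<phi> * (\<Sum>U\<in>{U\<in>Pow T. U \<subseteq> T - \<phi> ` S}. prod w U))"
  proof (intro sum.cong arg_cong2[where f = "(*)"] refl)
    fix \<phi>
    have "{U\<in>Pow T. U \<subseteq> T - \<phi> ` S} = Pow (T - \<phi> ` S)" by auto
    then show "(\<Prod>t\<in>T - \<phi> ` S. 1 + w t) = (\<Sum>U\<in>{U\<in>Pow T. U \<subseteq> T - \<phi> ` S}. prod w U)"
      using prod_add[of "T - \<phi> ` S" w "\<lambda>_. 1"] \<open>finite T\<close> by (simp add: add.commute)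
  qed
  also have "\<dots> = (\<Sum>U\<in>Pow T. prod w U * ?W (T - U))" by (rule swap) simp
  also have "\<dots> \<le> (\<Sum>U\<in>Pow T. prod w U * (?W T * prod q U))"
    using assms unfolding q_def
    by (intro sum_mono mult_left_mono matching_weight_diff_le prod_nonneg) (auto intro: finite_subset)
  also have "\<dots> = ?W T * (\<Sum>U\<in>Pow T. prod (\<lambda>t. w t * q t) U)"
    by (simp add: sum_distrib_left prod.distrib mult_ac)
  also have "\<dots> = ?W T * (\<Prod>t\<in>T. 1 + w t * q t)"
    using prod_add[of T "\<lambda>t. w t * q t" "\<lambda>_. 1"] \<open>finite T\<close> by (simp add: add.commute)
  also have "\<dots> \<le> ?W T * (\<Prod>t\<in>T. exp (w t * q t))"
    using pos w q0 by (intro mult_left_mono prod_mono) (auto simp: exp_ge_add_one_self add_nonneg_nonneg)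
  also have "\<dots> = ?W T * exp (\<Sum>t\<in>T. w t * q t)"
    using \<open>finite T\<close> by (simp add: exp_sum)
  also have "(\<Sum>t\<in>T. w t * q t) = (\<Sum>t\<in>T. w t * ?W (T - {t})) / ?W T"
    by (simp add: q_def sum_divide_distrib)
  also have "(\<Sum>t\<in>T. w t * ?W (T - {t})) = (\<Sum>U\<in>(\<lambda>t. {t}) ` T. sum w U * ?W (T - U))"
    by (subst sum.reindex) auto
  also have "\<dots> = (\<Sum>\<phi>\<in>injections S T. ?p \<phi> * (\<Sum>U\<in>{U\<in>(\<lambda>t. {t}) ` T. U \<subseteq> T - \<phi> ` S}. sum w U))"
    by (rule swap[symmetric]) auto
  also have "\<dots> = (\<Sum>\<phi>\<in>injections S T. ?p \<phi> * (\<Sum>t\<in>T - \<phi> ` S. w t))"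
  proof (intro sum.cong arg_cong2[where f = "(*)"] refl)
    fix \<phi>
    have "{U\<in>(\<lambda>t. {t}) ` T. U \<subseteq> T - \<phi> ` S} = (\<lambda>t. {t}) ` (T - \<phi> ` S)" by auto
    then show "(\<Sum>U\<in>{U\<in>(\<lambda>t. {t}) ` T. U \<subseteq> T - \<phi> ` S}. sum w U) = (\<Sum>t\<in>T - \<phi> ` S. w t)"
      by (simp add: sum.reindex)
  qed
  finally show ?thesis .
qed

text \<open>With \<open>u t = (\<Sum>s\<in>R - S. x s * b s t)\<close> this is the coefficient of
  the product of the variables \<open>x s\<close>, \<open>s \<in> S\<close>, in
  \<open>\<Prod>t\<in>T. \<Sum>s\<in>R. x s * b s t\<close>, read as a polynomial in those
  variables. Empty \<open>S\<close> gives the whole product, and \<open>S = R\<close> with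
  \<open>card R = card T\<close> gives the permanent.\<close>

definition matching_poly :: "('a \<Rightarrow> 'b \<Rightarrow> real) \<Rightarrow> 'a set \<Rightarrow> 'b set \<Rightarrow> ('b \<Rightarrow> real) \<Rightarrow> real" where
  "matching_poly b S T u =
     (\<Sum>\<phi>\<in>injections S T. (\<Prod>s\<in>S. b s (\<phi> s)) * (\<Prod>t\<in>T - \<phi> ` S. u t))"

lemma injections_empty: "injections {} T = {\<lambda>_. undefined}"
  by (auto simp: injections_def)

lemma injections_nonempty:
  assumes "finite S" "finite T" "card S \<le> card T"
  shows "injections S T \<noteq> {}"
proof -
  obtain f where "f ` S \<subseteq> T" "inj_on f S" using card_le_inj[OF assms] by blast
  then have "restrict f S \<in> injections S T" by (auto simp: injections_def inj_on_def)
  then show ?thesis by blast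
qed

lemma card_diff_image_injection:
  assumes "\<phi> \<in> injections S T" "finite S"
  shows "card (T - \<phi> ` S) = card T - card S"
  using assms by (subst card_Diff_subset) (auto simp: injections_def card_image)

lemma matching_poly_pos:
  assumes "finite S" "finite T" "card S \<le> card T" "\<And>s t. 0 < b s t" "\<And>t. 0 < u t"
  shows "0 < matching_poly b S T u"
  unfolding matching_poly_def using assms
  by (intro sum_pos finite_injections injections_nonempty mult_pos_pos prod_pos) auto

text \<open>A matching of \<open>insert j S\<close> is a matching of \<open>S\<close> together with
  an unmatched target \<open>i\<close> for \<open>j\<close>. The right-hand side is the derivative
  at \<tau> = 0 of \<open>matching_poly b S T (\<lambda>t. u t + \<tau> * b j t)\<close>.\<close>

lemma matching_poly_insert:
  assumes "finite S" "finite T" "j \<notin> S"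
  shows "matching_poly b (insert j S) T u =
    (\<Sum>\<phi>\<in>injections S T. (\<Prod>s\<in>S. b s (\<phi> s)) *
       (\<Sum>i\<in>T - \<phi> ` S. b j i * (\<Prod>t\<in>T - \<phi> ` S - {i}. u t)))"
proof -
  let ?g = "\<lambda>(\<phi>, i). (\<Prod>s\<in>S. b s (\<phi> s)) * (b j i * (\<Prod>t\<in>T - \<phi> ` S - {i}. u t))"
  have img: "(\<phi>(j := i)) ` insert j S = insert i (\<phi> ` S)" for \<phi> :: "'a \<Rightarrow> 'b" and i
    using \<open>j \<notin> S\<close> by auto
  have "(\<Sum>\<phi>\<in>injections S T. (\<Prod>s\<in>S. b s (\<phi> s)) *
       (\<Sum>i\<in>T - \<phi> ` S. b j i * (\<Prod>t\<in>T - \<phi> ` S - {i}. u t)))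
    = (\<Sum>p\<in>Sigma (injections S T) (\<lambda>\<phi>. T - \<phi> ` S). ?g p)"
    using assms by (simp add: sum_distrib_left sum.Sigma finite_injections)
  also have "\<dots> = matching_poly b (insert j S) T u"
    unfolding matching_poly_def
  proof (rule sum.reindex_bij_witness[where
        i = "\<lambda>\<psi>. (restrict \<psi> S, \<psi> j)" and j = "\<lambda>(\<phi>, i). \<phi>(j := i)"])
    fix p assume "p \<in> Sigma (injections S T) (\<lambda>\<phi>. T - \<phi> ` S)"
    then obtain \<phi> i where p: "p = (\<phi>, i)" "\<phi> \<in> injections S T" "i \<in> T" "i \<notin> \<phi> ` S" by auto
    then have ext: "\<phi> s = undefined" if "s \<notin> S" for s
      using that by (auto simp: injections_def)
    show "(\<lambda>\<psi>. (restrict \<psi> S, \<psi> j)) ((\<lambda>(\<phi>, i). \<phi>(j := i)) p) = p"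
      using \<open>j \<notin> S\<close> p ext by (auto simp: fun_eq_iff)
    have "inj_on (\<phi>(j := i)) (insert j S)"
      using p \<open>j \<notin> S\<close> by (auto simp: injections_def inj_on_def)
    then show "(\<lambda>(\<phi>, i). \<phi>(j := i)) p \<in> injections (insert j S) T"
      using p \<open>j \<notin> S\<close> by (auto simp: injections_def PiE_def extensional_def)
    have "(\<Prod>s\<in>S. b s ((\<phi>(j := i)) s)) = (\<Prod>s\<in>S. b s (\<phi> s))"
      using \<open>j \<notin> S\<close> by (intro prod.cong) auto
    moreover have "T - (\<phi>(j := i)) ` insert j S = T - \<phi> ` S - {i}"
      unfolding img by (rule Diff_insert)
    ultimately show "(\<Prod>s\<in>insert j S. b s ((\<lambda>(\<phi>, i). \<phi>(j := i)) p s)) *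
        (\<Prod>t\<in>T - (\<lambda>(\<phi>, i). \<phi>(j := i)) p ` insert j S. u t) = ?g p"
      using assms(1,3) unfolding p(1) prod.case by (simp del: image_insert)
  next
    fix \<psi> assume \<psi>: "\<psi> \<in> injections (insert j S) T"
    then show "(restrict \<psi> S, \<psi> j) \<in> Sigma (injections S T) (\<lambda>\<phi>. T - \<phi> ` S)"
      using \<open>j \<notin> S\<close> by (auto simp: injections_def inj_on_def)
    show "(\<lambda>(\<phi>, i). \<phi>(j := i)) (restrict \<psi> S, \<psi> j) = \<psi>"
      using \<psi> by (auto simp: injections_def fun_eq_iff)
  qed
  finally show ?thesis by simp
qed

text \<open>The exponent is \<tau> times the logarithmic derivative at 0, so the logarithm lies
  below its tangent there, as for a polynomial with only negative real roots. Dividing all weights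
  by \<open>u\<close> reduces this to \<open>matching_weight_exp_bound\<close>.\<close>

lemma matching_poly_exp_bound:
  assumes "finite S" "finite T" "card S \<le> card T" "j \<notin> S"
    and b: "\<And>s t. 0 < b s t" and u: "\<And>t. 0 < u t" and "0 \<le> \<tau>"
  shows "matching_poly b S T (\<lambda>t. u t + \<tau> * b j t)
    \<le> matching_poly b S T u * exp (\<tau> * matching_poly b (insert j S) T u / matching_poly b S T u)"
proof -
  define c where "c s t = b s t / u t" for s t
  define w where "w t = \<tau> * b j t / u t" for t
  define P where "P = (\<Prod>t\<in>T. u t)"
  let ?p = "\<lambda>\<phi>. \<Prod>s\<in>S. c s (\<phi> s)"
  have u0: "u t \<noteq> 0" for t using u[of t] by simp
  have P: "P > 0" unfolding P_def by (intro prod_pos u)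
  have weight: "(\<Prod>s\<in>S. b s (\<phi> s)) * (\<Prod>t\<in>T - \<phi> ` S. u t) = P * ?p \<phi>" if "\<phi> \<in> injections S T" for \<phi>
  proof -
    have \<phi>: "inj_on \<phi> S" "\<phi> ` S \<subseteq> T" using that by (auto simp: injections_def)
    have "(\<Prod>s\<in>S. b s (\<phi> s)) = (\<Prod>s\<in>S. c s (\<phi> s) * u (\<phi> s))"
      by (intro prod.cong) (auto simp: c_def u0)
    also have "\<dots> = ?p \<phi> * (\<Prod>t\<in>\<phi> ` S. u t)"
      using \<phi> by (simp add: prod.distrib prod.reindex)
    finally show ?thesis
      using prod.subset_diff[OF \<phi>(2) \<open>finite T\<close>, of u] by (simp add: P_def mult_ac)
  qed
  have 1: "matching_poly b S T u = P * matching_weight c S T"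
    by (simp add: matching_poly_def matching_weight_def sum_distrib_left weight)
  then have W: "matching_weight c S T > 0"
    using matching_poly_pos[OF assms(1-3), of b u] b u P by (simp add: zero_less_mult_iff)
  have "matching_poly b S T (\<lambda>t. u t + \<tau> * b j t)
      = (\<Sum>\<phi>\<in>injections S T. P * ?p \<phi> * (\<Prod>t\<in>T - \<phi> ` S. 1 + w t))"
    unfolding matching_poly_def
  proof (rule sum.cong[OF refl])
    fix \<phi> assume \<phi>: "\<phi> \<in> injections S T"
    have "(\<Prod>t\<in>T - \<phi> ` S. u t + \<tau> * b j t) = (\<Prod>t\<in>T - \<phi> ` S. u t * (1 + w t))"
      by (intro prod.cong) (auto simp: w_def u0 distrib_left)
    then show "(\<Prod>s\<in>S. b s (\<phi> s)) * (\<Prod>t\<in>T - \<phi> ` S. u t + \<tau> * b j t)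
        = P * ?p \<phi> * (\<Prod>t\<in>T - \<phi> ` S. 1 + w t)"
      using weight[OF \<phi>] by (simp add: prod.distrib)
  qed
  then have 2: "matching_poly b S T (\<lambda>t. u t + \<tau> * b j t)
      = P * (\<Sum>\<phi>\<in>injections S T. ?p \<phi> * (\<Prod>t\<in>T - \<phi> ` S. 1 + w t))"
    by (simp add: sum_distrib_left mult_ac)
  have "\<tau> * matching_poly b (insert j S) T u = (\<Sum>\<phi>\<in>injections S T. P * ?p \<phi> * (\<Sum>t\<in>T - \<phi> ` S. w t))"
    unfolding matching_poly_insert[OF assms(1,2,4)] sum_distrib_left[of \<tau>]
  proof (rule sum.cong[OF refl])
    fix \<phi> assume \<phi>: "\<phi> \<in> injections S T"
    have "\<tau> * (b j i * (\<Prod>t\<in>T - \<phi> ` S - {i}. u t)) = (\<Prod>t\<in>T - \<phi> ` S. u t) * w i" if "i \<in> T - \<phi> ` S" for i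
      using that \<open>finite T\<close> prod.remove[of "T - \<phi> ` S" i u] by (simp add: w_def u0)
    then show "\<tau> * ((\<Prod>s\<in>S. b s (\<phi> s)) * (\<Sum>i\<in>T - \<phi> ` S. b j i * (\<Prod>t\<in>T - \<phi> ` S - {i}. u t)))
        = P * ?p \<phi> * (\<Sum>t\<in>T - \<phi> ` S. w t)"
      unfolding weight[OF \<phi>, symmetric] sum_distrib_left by (intro sum.cong) (simp_all add: mult_ac)
  qed
  then have 3: "\<tau> * matching_poly b (insert j S) T u
      = P * (\<Sum>\<phi>\<in>injections S T. ?p \<phi> * (\<Sum>t\<in>T - \<phi> ` S. w t))"
    by (simp add: sum_distrib_left mult_ac)
  have "(\<Sum>\<phi>\<in>injections S T. ?p \<phi> * (\<Prod>t\<in>T - \<phi> ` S. 1 + w t))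
    \<le> matching_weight c S T * exp ((\<Sum>\<phi>\<in>injections S T. ?p \<phi> * (\<Sum>t\<in>T - \<phi> ` S. w t)) / matching_weight c S T)"
    using b u \<open>0 \<le> \<tau>\<close> W less_imp_le[OF b] less_imp_le[OF u]
    by (intro matching_weight_exp_bound assms W) (auto simp: c_def w_def)
  then show ?thesis
    using P unfolding 1 2 3 by (simp add: mult.assoc)
qed

text \<open>The column sums make each factor on the right a weighted mean of the \<open>x s\<close>,
  hence at least the weighted geometric mean by convexity of \<open>exp\<close>; by the row sums,
  every \<open>x s\<close> then occurs with total exponent 1. This is the capacity bound before any
  source is matched.\<close>

lemma prod_le_prod_weighted_sum:
  fixes b :: "'a \<Rightarrow> 'b \<Rightarrow> real"
  assumes "finite S" "finite T" and b: "\<And>s t. 0 \<le> b s t"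
    and row: "\<And>s. s \<in> S \<Longrightarrow> (\<Sum>t\<in>T. b s t) = 1" and col: "\<And>t. t \<in> T \<Longrightarrow> (\<Sum>s\<in>S. b s t) = 1"
    and x: "\<And>s. 0 < x s"
  shows "(\<Prod>s\<in>S. x s) \<le> (\<Prod>t\<in>T. \<Sum>s\<in>S. x s * b s t)"
proof -
  have "exp (\<Sum>s\<in>S. b s t * ln (x s)) \<le> (\<Sum>s\<in>S. x s * b s t)" if "t \<in> T" for t
  proof -
    have "S \<noteq> {}" using col[OF that] by auto
    then have "exp (\<Sum>s\<in>S. b s t *\<^sub>R ln (x s)) \<le> (\<Sum>s\<in>S. b s t * exp (ln (x s)))"
      using \<open>finite S\<close> col[OF that] b by (intro convex_on_sum[OF _ _ exp_convex]) auto
    then show ?thesis using x by (simp add: mult.commute)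
  qed
  then have "(\<Prod>t\<in>T. exp (\<Sum>s\<in>S. b s t * ln (x s))) \<le> (\<Prod>t\<in>T. \<Sum>s\<in>S. x s * b s t)"
    by (intro prod_mono) auto
  moreover have "(\<Prod>t\<in>T. exp (\<Sum>s\<in>S. b s t * ln (x s))) = exp (\<Sum>t\<in>T. \<Sum>s\<in>S. b s t * ln (x s))"
    using \<open>finite T\<close> by (simp add: exp_sum)
  moreover have "(\<Sum>t\<in>T. \<Sum>s\<in>S. b s t * ln (x s)) = (\<Sum>s\<in>S. ln (x s))"
    by (subst sum.swap) (simp add: row flip: sum_distrib_right)
  moreover have "exp (\<Sum>s\<in>S. ln (x s)) = (\<Prod>s\<in>S. x s)"
    using \<open>finite S\<close> x by (simp add: exp_sum)
  ultimately show ?thesis by simp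
qed

text \<open>
  Gurvits' capacity argument: passing from the matched sources \<open>S\<close> to \<open>insert j S\<close> takes the
  derivative at \<open>0\<close> in the variable \<open>x j\<close> and costs at most a factor \<open>e\<close> of capacity.
\<close>

lemma matching_poly_capacity:
  fixes b :: "'a \<Rightarrow> 'b \<Rightarrow> real"
  assumes fin: "finite R" "finite T" and card: "card R = card T" and b: "\<And>s t. 0 < b s t"
    and row: "\<And>s. s \<in> R \<Longrightarrow> (\<Sum>t\<in>T. b s t) = 1" and col: "\<And>t. t \<in> T \<Longrightarrow> (\<Sum>s\<in>R. b s t) = 1"
    and "S \<subseteq> R" and x: "\<And>s. 0 < x s"
  shows "exp (- real (card S)) * (\<Prod>s\<in>R - S. x s)
    \<le> matching_poly b S T (\<lambda>t. \<Sum>s\<in>R - S. x s * b s t)"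
  using finite_subset[OF \<open>S \<subseteq> R\<close> fin(1)] \<open>S \<subseteq> R\<close> x
proof (induction S arbitrary: x rule: finite_induct)
  case empty
  show ?case
    using prod_le_prod_weighted_sum[OF fin less_imp_le[OF b] row col empty.prems(2)]
    by (simp add: matching_poly_def injections_empty)
next
  case (insert j S)
  define Q where "Q = R - insert j S"
  define u where "u t = (\<Sum>s\<in>Q. x s * b s t)" for t
  have Q: "R - S = insert j Q" "j \<notin> Q" "finite Q" using insert fin by (auto simp: Q_def)
  have "card (insert j S) \<le> card R" using insert.prems(1) fin by (intro card_mono)
  then have cards: "card (insert j S) \<le> card T" "card S \<le> card T" using insert card by auto
  have IH: "exp (- real (card S)) * (\<tau> * (\<Prod>s\<in>Q. x s)) \<le> matching_poly b S T (\<lambda>t. u t + \<tau> * b j t)"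
    if "0 < \<tau>" for \<tau>
  proof -
    have 1: "(\<Prod>s\<in>R - S. (x(j := \<tau>)) s) = \<tau> * (\<Prod>s\<in>Q. x s)"
      unfolding Q(1) using Q(2,3) by (auto intro!: prod.cong)
    have 2: "(\<Sum>s\<in>R - S. (x(j := \<tau>)) s * b s t) = u t + \<tau> * b j t" for t
      unfolding Q(1) u_def using Q(2,3) by (auto intro!: sum.cong)
    show ?thesis
      using insert.IH[of "x(j := \<tau>)"] insert.prems that unfolding 1 2 by auto
  qed
  have "exp (- real (card (insert j S))) * (\<Prod>s\<in>Q. x s) \<le> matching_poly b (insert j S) T u"
  proof (cases "Q = {}")
    \<comment> \<open>Without remaining variables \<open>u\<close> vanishes and cannot be divided
      by. As a single target stays unmatched, the polynomial in \<tau> is then linear and no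
      exponential bound is called for.\<close>
    case True
    then have u0: "u = (\<lambda>t. 0)" by (simp add: u_def fun_eq_iff)
    have "R = insert j S" using True insert.prems(1) by (auto simp: Q_def)
    then have cT: "card T = Suc (card S)" using card insert by simp
    have "matching_poly b S T (\<lambda>t. b j t) = matching_poly b (insert j S) T u"
      unfolding matching_poly_insert[OF insert(1) fin(2) insert(2)] matching_poly_def[of b S]
    proof (rule sum.cong[OF refl])
      fix \<phi> assume "\<phi> \<in> injections S T"
      then have "card (T - \<phi> ` S) = 1" using card_diff_image_injection insert(1) cT by fastforce
      then obtain i where "T - \<phi> ` S = {i}" by (auto simp: card_1_singleton_iff)
      then show "(\<Prod>s\<in>S. b s (\<phi> s)) * (\<Prod>t\<in>T - \<phi> ` S. b j t)
        = (\<Prod>s\<in>S. b s (\<phi> s)) * (\<Sum>i\<in>T - \<phi> ` S. b j i * (\<Prod>t\<in>T - \<phi> ` S - {i}. u t))" by simp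
    qed
    moreover have "exp (- real (card (insert j S))) \<le> exp (- real (card S))" using insert by simp
    moreover have "exp (- real (card S)) \<le> matching_poly b S T (\<lambda>t. b j t)"
      using IH[of 1] True u0 by simp
    ultimately have "exp (- real (card (insert j S))) \<le> matching_poly b (insert j S) T u"
      by linarith
    then show ?thesis using True by simp
  next
    case False
    have u: "0 < u t" for t
      unfolding u_def using False Q(3) b insert.prems(2) by (intro sum_pos) auto
    define f where "f = matching_poly b S T u"
    define D where "D = matching_poly b (insert j S) T u"
    have f: "f > 0" unfolding f_def using insert fin cards b u by (intro matching_poly_pos) auto
    have D: "D > 0" unfolding D_def using insert fin cards b u by (intro matching_poly_pos) auto
    \<comment> \<open>The choice \<open>\<tau> = f / D\<close> minimises
      \<open>f * exp (\<tau> * D / f) / \<tau>\<close>; the minimum is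
      \<open>D * exp 1\<close>.\<close>
    have "exp (- real (card S)) * (f / D * (\<Prod>s\<in>Q. x s)) \<le> matching_poly b S T (\<lambda>t. u t + f / D * b j t)"
      using f D by (intro IH) simp
    also have "\<dots> \<le> f * exp (f / D * D / f)"
      unfolding f_def D_def using insert fin cards b u f D
      by (intro matching_poly_exp_bound) (auto simp: f_def D_def)
    also have "\<dots> = f * exp 1" using f D by simp
    finally have "exp (- real (card S)) * (\<Prod>s\<in>Q. x s) \<le> D * exp 1"
      using f D by (simp add: field_simps)
    then have "exp (- real (card S)) / exp 1 * (\<Prod>s\<in>Q. x s) \<le> D" by (simp add: field_simps)
    moreover have "exp (- real (card (insert j S))) = exp (- real (card S)) / exp 1"
      using insert by (simp flip: exp_diff)
    ultimately show ?thesis by (simp add: D_def)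
  qed
  then show ?case by (simp add: Q_def u_def[abs_def])
qed

theorem permanent_doubly_stochastic_ge:
  fixes b :: "'a \<Rightarrow> 'b \<Rightarrow> real"
  assumes fin: "finite S" "finite T" and card: "card S = card T"
    and b: "\<And>s t. s \<in> S \<Longrightarrow> t \<in> T \<Longrightarrow> 0 \<le> b s t"
    and row: "\<And>s. s \<in> S \<Longrightarrow> (\<Sum>t\<in>T. b s t) = 1" and col: "\<And>t. t \<in> T \<Longrightarrow> (\<Sum>s\<in>S. b s t) = 1"
  shows "exp (- real (card S)) \<le> (\<Sum>\<phi>\<in>injections S T. \<Prod>s\<in>S. b s (\<phi> s))"
proof (cases "S = {}")
  case True
  then show ?thesis by (simp add: injections_empty)
next
  case False
  define n where "n = real (card S)"
  have n: "n > 0" using False fin by (simp add: n_def card_gt_0_iff)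
  \<comment> \<open>\<open>matching_poly_capacity\<close> asks for positive entries. Mixing with the
    matrix of entries \<open>1 / n\<close> keeps the matrix doubly stochastic, and \<eta> tends to 0
    at the end.\<close>
  define per where "per \<eta> = (\<Sum>\<phi>\<in>injections S T. \<Prod>s\<in>S. (1 - \<eta>) * b s (\<phi> s) + \<eta> / n)" for \<eta>
  have "exp (- n) \<le> per \<eta>" if \<eta>: "0 < \<eta>" "\<eta> < 1" for \<eta>
  proof -
    \<comment> \<open>The value 1 outside \<open>S \<times> T\<close> only makes \<open>c\<close>
      positive everywhere.\<close>
    define c where "c s t = (if s \<in> S \<and> t \<in> T then (1 - \<eta>) * b s t + \<eta> / n else 1)" for s t
    have "exp (- real (card S)) * (\<Prod>s\<in>S - S. 1) \<le> matching_poly c S T (\<lambda>t. \<Sum>s\<in>S - S. 1 * c s t)"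
    proof (rule matching_poly_capacity)
      show "0 < c s t" for s t
        using \<eta> b[of s t] n by (auto simp: c_def intro!: add_nonneg_pos mult_nonneg_nonneg)
      show "(\<Sum>t\<in>T. c s t) = 1" if "s \<in> S" for s
      proof -
        have "(\<Sum>t\<in>T. c s t) = (1 - \<eta>) * (\<Sum>t\<in>T. b s t) + card T * (\<eta> / n)"
          using that by (simp add: c_def sum.distrib sum_distrib_left)
        then show ?thesis using row[OF that] n card by (simp add: n_def)
      qed
      show "(\<Sum>s\<in>S. c s t) = 1" if "t \<in> T" for t
      proof -
        have "(\<Sum>s\<in>S. c s t) = (1 - \<eta>) * (\<Sum>s\<in>S. b s t) + card S * (\<eta> / n)"
          using that by (simp add: c_def sum.distrib sum_distrib_left)
        then show ?thesis using col[OF that] n by (simp add: n_def)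
      qed
    qed (use fin card in auto)
    also have "\<dots> = per \<eta>"
      unfolding matching_poly_def per_def
    proof (rule sum.cong[OF refl])
      fix \<phi> assume \<phi>: "\<phi> \<in> injections S T"
      then have e: "T - \<phi> ` S = {}"
        using card_diff_image_injection[OF \<phi>] fin card by simp
      have "(\<Prod>s\<in>S. c s (\<phi> s)) = (\<Prod>s\<in>S. (1 - \<eta>) * b s (\<phi> s) + \<eta> / n)"
        using \<phi> by (intro prod.cong) (auto simp: c_def injections_def)
      then show "(\<Prod>s\<in>S. c s (\<phi> s)) * (\<Prod>t\<in>T - \<phi> ` S. \<Sum>s\<in>S - S. 1 * c s t)
          = (\<Prod>s\<in>S. (1 - \<eta>) * b s (\<phi> s) + \<eta> / n)"
        unfolding e by simp
    qed
    finally show ?thesis by (simp add: n_def)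
  qed
  then have ev: "eventually (\<lambda>\<eta>. exp (- n) \<le> per \<eta>) (at_right 0)"
    using eventually_at_right_real[of 0 1] by (auto elim!: eventually_mono)
  have "(per \<longlongrightarrow> per 0) (at_right 0)"
    unfolding per_def by (intro tendsto_intros) (use n in auto)
  then have "exp (- n) \<le> per 0"
    using ev by (intro tendsto_lowerbound) auto
  then show ?thesis by (simp add: per_def n_def)
qed

subsection \<open>Pattern counts and entropy\<close>

lemma card_le_card_restrict:
  assumes "finite F" "finite A" "Y \<subseteq> F \<rightarrow>\<^sub>E A" "P \<subseteq> F"
  shows "card Y \<le> card ((\<lambda>y. restrict y P) ` Y) * card A ^ card (F - P)"
proof -
  let ?h = "\<lambda>y. (restrict y P, restrict y (F - P))"
  have "finite Y" using assms by (meson finite_PiE finite_subset)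
  have "inj_on ?h Y"
  proof (rule inj_onI)
    fix y z assume yz: "y \<in> Y" "z \<in> Y" "?h y = ?h z"
    then have "y \<in> F \<rightarrow>\<^sub>E A" "z \<in> F \<rightarrow>\<^sub>E A" using assms(3) by auto
    moreover have "y t = z t" if "t \<in> F" for t
    proof (cases "t \<in> P")
      case True
      then show ?thesis using yz(3) by (auto dest: fun_cong[where x = t])
    next
      case False
      then have "restrict y (F - P) t = restrict z (F - P) t" using yz(3) by simp
      then show ?thesis using False that by simp
    qed
    ultimately show "y = z" by (rule PiE_ext)
  qed
  moreover have "?h ` Y \<subseteq> (\<lambda>y. restrict y P) ` Y \<times> ((F - P) \<rightarrow>\<^sub>E A)"
    using subsetD[OF assms(3)] by (auto simp: PiE_iff split: if_splits)
  ultimately have "card Y \<le> card ((\<lambda>y. restrict y P) ` Y \<times> ((F - P) \<rightarrow>\<^sub>E A))"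
    using assms \<open>finite Y\<close> by (intro card_inj_on_le) (auto intro!: finite_PiE)
  then show ?thesis using assms by (simp add: card_cartesian_product card_PiE)
qed

section \<open>Patterns, shift invariance and the infimum over finite windows\<close>

locale finite_alphabet = group G for G (structure) +
  fixes A :: "'a set"
  assumes A_sub: "A \<subseteq> carrier G" and A_fin: "finite A" and A_ne: "A \<noteq> {}"
begin

abbreviation X where "X \<equiv> restricted_permutations G A"

definition patterns :: "'a set \<Rightarrow> ('a \<Rightarrow> 'a) set" where
  "patterns E = (\<lambda>x. restrict x E) ` X"

lemma X_PiE: "X \<subseteq> carrier G \<rightarrow>\<^sub>E A"
  by (auto simp: restricted_permutations_def)

lemma X_in: "x \<in> X \<Longrightarrow> s \<in> carrier G \<Longrightarrow> x s \<in> A"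
  using X_PiE by auto

lemma X_ne: "X \<noteq> {}"
proof -
  obtain a where a: "a \<in> A" using A_ne by auto
  then have "a \<in> carrier G" using A_sub by auto
  have "bij_betw (\<lambda>s. s \<otimes> a) (carrier G) (carrier G)"
    using \<open>a \<in> carrier G\<close>
    by (intro bij_betw_byWitness[where f' = "\<lambda>s. s \<otimes> inv a"]) (auto simp: m_assoc)
  then have "bij_betw (\<lambda>s. s \<otimes> (\<lambda>s\<in>carrier G. a) s) (carrier G) (carrier G)"
    by (simp cong: bij_betw_cong)
  then have "(\<lambda>s\<in>carrier G. a) \<in> X" using a by (simp add: restricted_permutations_def)
  then show ?thesis by blast
qed

text \<open>The permutation encoded by the shifted configuration is the conjugate of the original
  one by left multiplication by \<open>g\<close>.\<close>

lemma left_shift_X: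
  assumes g: "g \<in> carrier G" and x: "x \<in> X"
  shows "left_shift G g x \<in> X"
proof -
  have "bij_betw ((\<lambda>s. g \<otimes> s) \<circ> (\<lambda>s. s \<otimes> x s) \<circ> (\<lambda>s. inv g \<otimes> s)) (carrier G) (carrier G)"
  proof (intro bij_betw_trans)
    show "bij_betw (\<lambda>s. inv g \<otimes> s) (carrier G) (carrier G)" "bij_betw (\<lambda>s. g \<otimes> s) (carrier G) (carrier G)"
      using g
      by (intro bij_betw_byWitness[where f' = "\<lambda>s. g \<otimes> s"] bij_betw_byWitness[where f' = "\<lambda>s. inv g \<otimes> s"];
          auto simp flip: m_assoc)+
    show "bij_betw (\<lambda>s. s \<otimes> x s) (carrier G) (carrier G)"
      using x by (simp add: restricted_permutations_def)
  qed
  moreover have "((\<lambda>s. g \<otimes> s) \<circ> (\<lambda>s. s \<otimes> x s) \<circ> (\<lambda>s. inv g \<otimes> s)) s = s \<otimes> left_shift G g x s"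
    if "s \<in> carrier G" for s
  proof -
    have "x (inv g \<otimes> s) \<in> carrier G" using X_in[OF x, of "inv g \<otimes> s"] A_sub g that by auto
    then show ?thesis using that g by (simp add: left_shift_def flip: m_assoc)
  qed
  ultimately have "bij_betw (\<lambda>s. s \<otimes> left_shift G g x s) (carrier G) (carrier G)"
    by (simp cong: bij_betw_cong)
  then show ?thesis
    using X_in[OF x] g by (auto simp: restricted_permutations_def left_shift_def)
qed

lemma left_shift_inv:
  assumes "g \<in> carrier G" "x \<in> X"
  shows "left_shift G g (left_shift G (inv g) x) = x"
  using assms(1) subsetD[OF X_PiE assms(2)]
  by (auto simp: left_shift_def fun_eq_iff PiE_iff extensional_def simp flip: m_assoc)

lemma patterns_PiE: "E \<subseteq> carrier G \<Longrightarrow> patterns E \<subseteq> E \<rightarrow>\<^sub>E A"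
  using X_in by (auto simp: patterns_def)

lemma finite_patterns: "finite E \<Longrightarrow> E \<subseteq> carrier G \<Longrightarrow> finite (patterns E)"
  using patterns_PiE A_fin by (meson finite_PiE finite_subset)

lemma card_patterns_ge_1: "finite E \<Longrightarrow> E \<subseteq> carrier G \<Longrightarrow> 1 \<le> card (patterns E)"
  using finite_patterns X_ne by (simp add: patterns_def Suc_le_eq card_gt_0_iff)

lemma restrict_patterns: "F \<subseteq> E \<Longrightarrow> (\<lambda>y. restrict y F) ` patterns E = patterns F"
  by (auto simp: patterns_def image_image Int_absorb1)

lemma card_patterns_translate:
  assumes "g \<in> carrier G" "finite E" "E \<subseteq> carrier G"
  shows "card (patterns ((\<lambda>e. g \<otimes> e) ` E)) \<le> card (patterns E)"
proof -
  let ?t = "\<lambda>p. \<lambda>t\<in>(\<lambda>e. g \<otimes> e) ` E. p (inv g \<otimes> t)"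
  have "patterns ((\<lambda>e. g \<otimes> e) ` E) \<subseteq> ?t ` patterns E"
  proof
    fix p assume "p \<in> patterns ((\<lambda>e. g \<otimes> e) ` E)"
    then obtain x where x: "x \<in> X" "p = restrict x ((\<lambda>e. g \<otimes> e) ` E)" by (auto simp: patterns_def)
    let ?y = "left_shift G (inv g) x"
    have "?y \<in> X" using x assms by (simp add: left_shift_X)
    moreover have "p t = ?t (restrict ?y E) t" for t
    proof (cases "t \<in> (\<lambda>e. g \<otimes> e) ` E")
      case True
      then obtain e where e: "e \<in> E" "e \<in> carrier G" "t = g \<otimes> e" using assms by auto
      then have "inv g \<otimes> t = e" using assms by (simp flip: m_assoc)
      then show ?thesis using True e assms by (simp add: x(2) left_shift_def)
    qed (simp add: x(2))
    ultimately show "p \<in> ?t ` patterns E" unfolding patterns_def by blast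
  qed
  then show ?thesis using finite_patterns[OF assms(2,3)] by (rule surj_card_le[rotated])
qed

text \<open>The point \<open>f\<close> lies in \<open>gE\<close> exactly for the
  \<open>g = f \<otimes> inv e\<close>, so it is covered \<open>card E\<close> times as soon as all
  of these belong to \<open>G0\<close>. Shearer's inequality handles such points, and each other
  point costs a factor \<open>card A\<close>. The set \<open>Y\<close> is arbitrary so that it may
  also hold patterns that do not extend to \<open>X\<close>.\<close>

lemma pattern_count_tiling:
  assumes F: "finite F" "F \<subseteq> carrier G" and E: "finite E" "E \<noteq> {}" "E \<subseteq> carrier G"
    and G0: "finite G0" "G0 \<subseteq> carrier G" and Y: "Y \<subseteq> F \<rightarrow>\<^sub>E A"
    and N: "\<And>g. g \<in> G0 \<Longrightarrow> card ((\<lambda>y. restrict y ((\<lambda>e. g \<otimes> e) ` E \<inter> F)) ` Y) \<le> N"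
  shows "card Y ^ card E
    \<le> N ^ card G0 * (card A ^ card (F - {f\<in>F. \<forall>e\<in>E. f \<otimes> inv e \<in> G0})) ^ card E"
proof -
  define P where "P = {f\<in>F. \<forall>e\<in>E. f \<otimes> inv e \<in> G0}"
  let ?Y = "(\<lambda>y. restrict y P) ` Y"
  have "P \<subseteq> F" "finite P" using F by (auto simp: P_def)
  have finY: "finite Y" using F A_fin Y by (meson finite_PiE finite_subset)
  have "card ?Y ^ card E \<le> (\<Prod>g\<in>G0. card ((\<lambda>y. restrict y ((\<lambda>e. g \<otimes> e) ` E \<inter> P)) ` ?Y))"
  proof (rule shearer[OF \<open>finite P\<close> \<open>finite G0\<close> A_fin])
    show "0 < card E" using E by (simp add: card_gt_0_iff)
    show "?Y \<subseteq> P \<rightarrow>\<^sub>E A" using subsetD[OF Y] \<open>P \<subseteq> F\<close> by (auto simp: PiE_iff)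
    fix f assume f: "f \<in> P"
    then have fc: "f \<in> carrier G" using F by (auto simp: P_def)
    have "{g \<in> G0. f \<in> (\<lambda>e. g \<otimes> e) ` E} = (\<lambda>e. f \<otimes> inv e) ` E"
    proof (intro equalityI subsetI)
      fix g assume "g \<in> {g \<in> G0. f \<in> (\<lambda>e. g \<otimes> e) ` E}"
      then obtain e where e: "g \<in> carrier G" "e \<in> E" "e \<in> carrier G" "f = g \<otimes> e"
        using G0 E by auto
      then have "g = f \<otimes> inv e" by (simp add: m_assoc)
      then show "g \<in> (\<lambda>e. f \<otimes> inv e) ` E" using e by blast
    next
      fix g assume "g \<in> (\<lambda>e. f \<otimes> inv e) ` E"
      then obtain e where e: "e \<in> E" "g = f \<otimes> inv e" by blast
      then have "e \<in> carrier G" using E by auto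
      then have "f = g \<otimes> e" using fc e by (simp add: m_assoc)
      then show "g \<in> {g \<in> G0. f \<in> (\<lambda>e. g \<otimes> e) ` E}" using e f by (auto simp: P_def)
    qed
    moreover have "inj_on (\<lambda>e. f \<otimes> inv e) E"
    proof (rule inj_onI)
      fix e e' assume e: "e \<in> E" "e' \<in> E" "f \<otimes> inv e = f \<otimes> inv e'"
      then have "e \<in> carrier G" "e' \<in> carrier G" using E by auto
      then have "inv e = inv e'" using e fc by simp
      then show "e = e'" using \<open>e \<in> carrier G\<close> \<open>e' \<in> carrier G\<close> by (metis inv_inv)
    qed
    ultimately show "card {g \<in> G0. f \<in> (\<lambda>e. g \<otimes> e) ` E} = card E" by (simp add: card_image)
  qed
  also have "\<dots> \<le> (\<Prod>g\<in>G0. N)"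
  proof (rule prod_mono, safe)
    fix g assume g: "g \<in> G0"
    have "(\<lambda>y. restrict y ((\<lambda>e. g \<otimes> e) ` E \<inter> P)) ` ?Y
      = (\<lambda>y. restrict y P) ` (\<lambda>y. restrict y ((\<lambda>e. g \<otimes> e) ` E \<inter> F)) ` Y"
      using \<open>P \<subseteq> F\<close> by (auto simp: image_image restrict_def fun_eq_iff intro!: image_cong)
    then have "card ((\<lambda>y. restrict y ((\<lambda>e. g \<otimes> e) ` E \<inter> P)) ` ?Y)
      \<le> card ((\<lambda>y. restrict y ((\<lambda>e. g \<otimes> e) ` E \<inter> F)) ` Y)"
      using finY by (simp only: card_image_le finite_imageI)
    then show "card ((\<lambda>y. restrict y ((\<lambda>e. g \<otimes> e) ` E \<inter> P)) ` ?Y) \<le> N"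
      using N[OF g] by linarith
  qed
  finally have *: "card ?Y ^ card E \<le> N ^ card G0" by simp
  have "card Y \<le> card ?Y * card A ^ card (F - P)"
    using F A_fin Y \<open>P \<subseteq> F\<close> by (intro card_le_card_restrict)
  then have "card Y ^ card E \<le> (card ?Y * card A ^ card (F - P)) ^ card E" by (intro power_mono) auto
  also have "\<dots> = card ?Y ^ card E * (card A ^ card (F - P)) ^ card E" by (rule power_mult_distrib)
  also have "\<dots> \<le> N ^ card G0 * (card A ^ card (F - P)) ^ card E" using * by simp
  finally show ?thesis by (simp add: P_def)
qed

text \<open>An infimum over all windows instead of a limit: lower bounds can be proved one window at
  a time, and a single window gives an upper bound.\<close>

definition entropy_rate :: real where
  "entropy_rate = (INF E\<in>{E. finite E \<and> E \<noteq> {} \<and> E \<subseteq> carrier G}. ln (card (patterns E)) / card E)"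

lemma ln_card_patterns_nonneg:
  "finite E \<Longrightarrow> E \<subseteq> carrier G \<Longrightarrow> 0 \<le> ln (real (card (patterns E)))"
  using card_patterns_ge_1 by simp

lemma nonempty_finite_sets: "{E. finite E \<and> E \<noteq> {} \<and> E \<subseteq> carrier G} \<noteq> {}"
  by (auto intro!: exI[of _ "{\<one>}"])

lemma entropy_rate_le:
  assumes "finite E" "E \<noteq> {}" "E \<subseteq> carrier G"
  shows "entropy_rate \<le> ln (card (patterns E)) / card E"
  unfolding entropy_rate_def using assms
  by (intro cINF_lower bdd_belowI2[of _ 0] divide_nonneg_nonneg ln_card_patterns_nonneg) auto

lemma entropy_rate_ge:
  assumes "\<And>E. finite E \<Longrightarrow> E \<noteq> {} \<Longrightarrow> E \<subseteq> carrier G \<Longrightarrow> c \<le> ln (card (patterns E)) / card E"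
  shows "c \<le> entropy_rate"
  unfolding entropy_rate_def using assms nonempty_finite_sets by (intro cINF_greatest) auto

lemma entropy_rate_nonneg: "0 \<le> entropy_rate"
  by (intro entropy_rate_ge divide_nonneg_nonneg ln_card_patterns_nonneg) auto

text \<open>
  Shearer's inequality bounds \<open>card (patterns F)\<close> by the translates of one fixed \<open>E\<close>, so the limit
  exists and is an infimum, without the Ornstein-Weiss lemma.
\<close>

lemma entropy_rate_limit:
  "((\<lambda>F. ln (real (card (patterns F))) / real (card F)) \<longlongrightarrow> entropy_rate) (right_invariant G)"
proof (rule order_tendstoI)
  fix a assume a: "a < entropy_rate"
  show "eventually (\<lambda>F. a < ln (real (card (patterns F))) / real (card F)) (right_invariant G)"
    unfolding eventually_right_invariant[OF group_axioms]
    using a entropy_rate_le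
    by (intro exI[of _ "{\<one>}"] exI[of _ 1]) (force simp: right_invariant_sets_def)
next
  fix a assume a: "entropy_rate < a"
  then obtain E where E: "finite E" "E \<noteq> {}" "E \<subseteq> carrier G" and lt: "ln (card (patterns E)) / card E < a"
    using nonempty_finite_sets unfolding entropy_rate_def
    by (subst (asm) cINF_less_iff) (auto intro!: bdd_belowI2[of _ 0] divide_nonneg_nonneg ln_card_patterns_nonneg)
  define L where "L = ln (real (card (patterns E)))"
  have L: "0 \<le> L" using ln_card_patterns_nonneg E by (simp add: L_def)
  have cE: "0 < real (card E)" using E by (simp add: card_gt_0_iff)
  \<comment> \<open>Chosen so that \<open>(1 + \<delta>) * L < a * card E\<close>; the added 1
    guards against \<open>L = 0\<close>.\<close>
  define \<delta> where "\<delta> = (a * card E - L) / (L + 1)"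
  have aL: "L < a * card E" using lt cE by (simp add: L_def field_simps)
  then have \<delta>: "\<delta> > 0" using L by (simp add: \<delta>_def)
  have "\<delta> * L < \<delta> * (L + 1)" using \<delta> by simp
  also have "\<dots> = a * card E - L" using L by (simp add: \<delta>_def)
  finally have \<delta>L: "(1 + \<delta>) * L < a * card E" by (simp add: algebra_simps)
  \<comment> \<open>\<open>F <#> ?K\<close> consists of all \<open>g\<close> whose translate
    \<open>gE\<close> meets \<open>F\<close>, so every point of \<open>F\<close> is covered
    \<open>card E\<close> times and none is left over.\<close>
  let ?K = "(\<lambda>e. inv e) ` E"
  have bound: "ln (real (card (patterns F))) / real (card F) < a" if "F \<in> right_invariant_sets G ?K \<delta>" for F
  proof -
    have F: "finite F" "F \<noteq> {}" "F \<subseteq> carrier G" and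
      inv: "real (card (sym_diff (F <#> ?K) F)) < \<delta> * real (card F)"
      using that by (auto simp: right_invariant_sets_def)
    let ?G0 = "F <#> ?K"
    have K: "finite ?K" "?K \<subseteq> carrier G" using E by auto
    have G0: "finite ?G0" "?G0 \<subseteq> carrier G" using F K by (auto simp: finite_set_mult set_mult_closed)
    have cF: "0 < real (card F)" using F by (simp add: card_gt_0_iff)
    have "card ?G0 \<le> card (F \<union> sym_diff ?G0 F)" using F G0 by (intro card_mono) auto
    also have "\<dots> \<le> card F + card (sym_diff ?G0 F)" by (rule card_Un_le)
    finally have "real (card ?G0) \<le> (1 + \<delta>) * card F" using inv by (simp add: algebra_simps)
    then have G0_le: "real (card ?G0) * L \<le> (1 + \<delta>) * card F * L" using L by (rule mult_right_mono)
    have "card (patterns F) ^ card E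
      \<le> card (patterns E) ^ card ?G0 * (card A ^ card (F - {f\<in>F. \<forall>e\<in>E. f \<otimes> inv e \<in> ?G0})) ^ card E"
    proof (rule pattern_count_tiling[OF F(1,3) E G0 patterns_PiE[OF F(3)]])
      fix g assume "g \<in> ?G0"
      then have g: "g \<in> carrier G" using G0 by auto
      let ?gE = "(\<lambda>e. g \<otimes> e) ` E"
      have gE: "finite ?gE" "?gE \<subseteq> carrier G" using E g by auto
      have "(\<lambda>y. restrict y (?gE \<inter> F)) ` patterns F = (\<lambda>y. restrict y (?gE \<inter> F)) ` patterns ?gE"
        by (simp add: restrict_patterns)
      then have "card ((\<lambda>y. restrict y (?gE \<inter> F)) ` patterns F) \<le> card (patterns ?gE)"
        using finite_patterns[OF gE] by (simp only: card_image_le)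
      then show "card ((\<lambda>y. restrict y (?gE \<inter> F)) ` patterns F) \<le> card (patterns E)"
        using card_patterns_translate[OF g E(1,3)] by linarith
    qed
    moreover have "F - {f\<in>F. \<forall>e\<in>E. f \<otimes> inv e \<in> ?G0} = {}" by (auto simp: set_mult_def)
    ultimately have "card (patterns F) ^ card E \<le> card (patterns E) ^ card ?G0" by simp
    then have "real (card (patterns F)) ^ card E \<le> real (card (patterns E)) ^ card ?G0"
      by (simp flip: of_nat_power)
    then have "ln (real (card (patterns F)) ^ card E) \<le> ln (real (card (patterns E)) ^ card ?G0)"
      using card_patterns_ge_1[OF F(1,3)] card_patterns_ge_1[OF E(1,3)] by (intro ln_mono) auto
    then have "real (card E) * ln (real (card (patterns F))) \<le> real (card ?G0) * L"
      using card_patterns_ge_1[OF F(1,3)] card_patterns_ge_1[OF E(1,3)] by (simp add: ln_realpow L_def)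
    also have "\<dots> \<le> (1 + \<delta>) * L * card F" using G0_le by (simp add: mult_ac)
    also have "\<dots> < a * card E * card F" using \<delta>L cF by simp
    finally have "ln (real (card (patterns F))) < a * card F" using cE by (simp add: mult_ac)
    then show ?thesis using cF by (simp add: field_simps)
  qed
  show "eventually (\<lambda>F. ln (real (card (patterns F))) / real (card F) < a) (right_invariant G)"
    unfolding eventually_right_invariant[OF group_axioms]
    using E \<delta> bound by (intro exI[of _ ?K] exI[of _ \<delta>]) auto
qed


section \<open>Compactness and finite windows\<close>

abbreviation full_shift where
  "full_shift \<equiv> product_topology (\<lambda>_. discrete_topology A) (carrier G)"

lemma openin_cylinder:
  assumes "finite M" "M \<subseteq> carrier G"
  shows "openin full_shift {x \<in> carrier G \<rightarrow>\<^sub>E A. P (restrict x M)}"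
  unfolding openin_product_topology_alt
proof safe
  fix x assume x: "x \<in> carrier G \<rightarrow>\<^sub>E A" "P (restrict x M)"
  let ?U = "\<lambda>i. if i \<in> M then {x i} else A"
  have sub: "x i \<in> A" if "i \<in> carrier G" for i using x that by auto
  have "{i \<in> carrier G. ?U i \<noteq> topspace (discrete_topology A)} \<subseteq> M" by auto
  then have "finite {i \<in> carrier G. ?U i \<noteq> topspace (discrete_topology A)}"
    using assms finite_subset by blast
  moreover have "restrict y M = restrict x M" if "y \<in> Pi\<^sub>E (carrier G) ?U" for y
    using that assms by (fastforce simp: PiE_iff restrict_def fun_eq_iff split: if_splits)
  moreover have "y \<in> carrier G \<rightarrow>\<^sub>E A" if "y \<in> Pi\<^sub>E (carrier G) ?U" for y
    using that sub by (auto simp: PiE_iff split: if_splits)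
  ultimately show "\<exists>U. finite {i \<in> carrier G. U i \<noteq> topspace (discrete_topology A)} \<and>
      (\<forall>i\<in>carrier G. openin (discrete_topology A) (U i)) \<and> x \<in> Pi\<^sub>E (carrier G) U \<and>
      Pi\<^sub>E (carrier G) U \<subseteq> {x \<in> carrier G \<rightarrow>\<^sub>E A. P (restrict x M)}"
    using x sub by (intro exI[of _ ?U]) auto
qed

lemma closedin_cylinder:
  assumes "finite M" "M \<subseteq> carrier G"
  shows "closedin full_shift {x \<in> carrier G \<rightarrow>\<^sub>E A. P (restrict x M)}"
proof -
  have "(carrier G \<rightarrow>\<^sub>E A) - {x \<in> carrier G \<rightarrow>\<^sub>E A. P (restrict x M)}
    = {x \<in> carrier G \<rightarrow>\<^sub>E A. \<not> P (restrict x M)}" by blast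
  then show ?thesis
    using openin_cylinder[OF assms, of "\<lambda>x. \<not> P x"] by (auto simp: closedin_def)
qed

lemma compact_full_shift: "compact_space full_shift"
  using A_fin by (simp add: compact_space_product_topology compact_space_discrete_topology)

text \<open>A point \<open>t\<close> can be hit only from the finitely many
  \<open>t \<otimes> inv a\<close>, which makes surjectivity testable on finite windows. Restricting
  the second clause to those \<open>t\<close> whose candidates all lie in \<open>M\<close> yields a
  condition that reads only the values on \<open>M\<close> and passes to smaller windows.\<close>

definition locally_bijective :: "('a \<Rightarrow> 'a) \<Rightarrow> 'a set \<Rightarrow> bool" where
  "locally_bijective x M \<longleftrightarrow> inj_on (\<lambda>s. s \<otimes> x s) M \<and>
     (\<forall>t\<in>carrier G. (\<lambda>a. t \<otimes> inv a) ` A \<subseteq> M \<longrightarrow> t \<in> (\<lambda>s. s \<otimes> x s) ` M)"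

lemma locally_bijective_cong:
  assumes "\<And>s. s \<in> M \<Longrightarrow> x s = y s"
  shows "locally_bijective x M \<longleftrightarrow> locally_bijective y M"
proof -
  have "(\<lambda>s. s \<otimes> x s) ` M = (\<lambda>s. s \<otimes> y s) ` M" using assms by auto
  moreover have "inj_on (\<lambda>s. s \<otimes> x s) M = inj_on (\<lambda>s. s \<otimes> y s) M"
    using assms by (intro inj_on_cong) auto
  ultimately show ?thesis by (simp add: locally_bijective_def)
qed

text \<open>If \<open>t\<close> is hit from \<open>s\<close>, then
  \<open>s = t \<otimes> inv (x s)\<close> is one of the candidates, so it lies in \<open>M\<close>
  as soon as all candidates do.\<close>

lemma locally_bijective_mono:
  assumes "locally_bijective x M'" "M \<subseteq> M'" "M' \<subseteq> carrier G" "\<And>s. s \<in> M' \<Longrightarrow> x s \<in> A"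
  shows "locally_bijective x M"
  unfolding locally_bijective_def
proof (intro conjI ballI impI)
  show "inj_on (\<lambda>s. s \<otimes> x s) M"
    using assms(1,2) inj_on_subset by (auto simp: locally_bijective_def)
  fix t assume t: "t \<in> carrier G" "(\<lambda>a. t \<otimes> inv a) ` A \<subseteq> M"
  then obtain s where s: "s \<in> M'" "t = s \<otimes> x s"
    using assms(1,2) unfolding locally_bijective_def by blast
  have "x s \<in> A" using s assms by auto
  then have "x s \<in> carrier G" "s \<in> carrier G" using A_sub s assms by auto
  then have "s = t \<otimes> inv (x s)" using s by (simp add: m_assoc)
  then have "s \<in> M" using t \<open>x s \<in> A\<close> by blast
  then show "t \<in> (\<lambda>s. s \<otimes> x s) ` M" using s by blast
qed

text \<open>Two-point windows test injectivity, and the window of all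
  \<open>t \<otimes> inv a\<close> tests surjectivity at \<open>t\<close>.\<close>

lemma X_iff_locally_bijective:
  "x \<in> X \<longleftrightarrow> x \<in> carrier G \<rightarrow>\<^sub>E A \<and> (\<forall>M. finite M \<and> M \<subseteq> carrier G \<longrightarrow> locally_bijective x M)"
proof (intro iffI conjI allI impI)
  fix M assume x: "x \<in> X" and M: "finite M \<and> M \<subseteq> carrier G"
  have "locally_bijective x (carrier G)"
    using x by (auto simp: restricted_permutations_def locally_bijective_def bij_betw_def)
  then show "locally_bijective x M"
    by (rule locally_bijective_mono) (use M X_in[OF x] in auto)
next
  assume x: "x \<in> carrier G \<rightarrow>\<^sub>E A \<and> (\<forall>M. finite M \<and> M \<subseteq> carrier G \<longrightarrow> locally_bijective x M)"
  have xA: "x s \<in> carrier G" if "s \<in> carrier G" for s using x that A_sub by blast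
  have "inj_on (\<lambda>s. s \<otimes> x s) (carrier G)"
  proof (rule inj_onI)
    fix s s' assume s: "s \<in> carrier G" "s' \<in> carrier G" "s \<otimes> x s = s' \<otimes> x s'"
    then have "locally_bijective x {s, s'}" using x by auto
    then have "inj_on (\<lambda>s. s \<otimes> x s) {s, s'}" by (simp only: locally_bijective_def)
    then show "s = s'" by (rule inj_onD) (use s in auto)
  qed
  moreover have "t \<in> (\<lambda>s. s \<otimes> x s) ` carrier G" if t: "t \<in> carrier G" for t
  proof -
    let ?M = "(\<lambda>a. t \<otimes> inv a) ` A"
    have M: "finite ?M" "?M \<subseteq> carrier G" using A_fin A_sub t by auto
    then have "locally_bijective x ?M" using x by auto
    then have "t \<in> (\<lambda>s. s \<otimes> x s) ` ?M" using t by (auto simp: locally_bijective_def)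
    then show ?thesis using M by blast
  qed
  ultimately show "x \<in> X"
    using x xA by (auto simp: restricted_permutations_def bij_betw_def)
qed (use X_PiE in blast)

lemma closedin_locally_bijective:
  assumes "finite M" "M \<subseteq> carrier G"
  shows "closedin full_shift {x \<in> carrier G \<rightarrow>\<^sub>E A. locally_bijective x M \<and> P (restrict x M)}"
proof -
  have "locally_bijective (restrict x M) M \<longleftrightarrow> locally_bijective x M" for x
    by (rule locally_bijective_cong) simp
  then show ?thesis
    using closedin_cylinder[OF assms, of "\<lambda>y. locally_bijective y M \<and> P y"] by simp
qed

lemma compact_X: "compact_space (restricted_permutations_space G A)"
proof -
  let ?\<M> = "{M. finite M \<and> M \<subseteq> carrier G}"
  have "X = (\<Inter>M\<in>?\<M>. {x \<in> carrier G \<rightarrow>\<^sub>E A. locally_bijective x M \<and> True})"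
    using X_iff_locally_bijective by auto
  moreover have "closedin full_shift (\<Inter>M\<in>?\<M>. {x \<in> carrier G \<rightarrow>\<^sub>E A. locally_bijective x M \<and> True})"
    using closedin_locally_bijective[where P = "\<lambda>_. True"] by (intro closedin_Inter) auto
  ultimately have "closedin full_shift X" by simp
  then show ?thesis
    unfolding restricted_permutations_space_def
    using closedin_compact_space[OF compact_full_shift] compactin_subspace by blast
qed

text \<open>If no window worked, the configurations that are locally bijective on \<open>M\<close>
  but show a pattern outside \<open>patterns E\<close> would form nonempty closed sets, decreasing
  in \<open>M\<close>. A common point would be locally bijective on every window, hence lie in
  \<open>X\<close>, a contradiction.\<close>

lemma locally_bijective_extends:
  assumes E: "finite E" "E \<subseteq> carrier G"
  obtains M where "finite M" "E \<subseteq> M" "M \<subseteq> carrier G"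
    "\<And>x. x \<in> carrier G \<rightarrow>\<^sub>E A \<Longrightarrow> locally_bijective x M \<Longrightarrow> restrict x E \<in> patterns E"
proof (rule ccontr)
  note extends = that
  assume no: "\<not> thesis"
  let ?C = "\<lambda>M. {x \<in> carrier G \<rightarrow>\<^sub>E A. locally_bijective x M \<and> restrict x E \<notin> patterns E}"
  let ?\<M> = "{M. finite M \<and> E \<subseteq> M \<and> M \<subseteq> carrier G}"
  have ne: "?C M \<noteq> {}" if "M \<in> ?\<M>" for M using no extends[of M] that by auto
  have closed: "closedin full_shift (?C M)" if M: "M \<in> ?\<M>" for M
  proof -
    have "M \<inter> E = E" using M by blast
    then show ?thesis
      using closedin_locally_bijective[of M "\<lambda>y. restrict y E \<notin> patterns E"] M by simp
  qed
  have fip: "\<Inter>\<F> \<noteq> {}" if \<F>: "finite \<F>" "\<F> \<subseteq> ?C ` ?\<M>" for \<F>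
  proof -
    obtain \<N> where \<N>: "finite \<N>" "\<N> \<subseteq> ?\<M>" "\<F> = ?C ` \<N>" using finite_subset_image[OF \<F>] by blast
    \<comment> \<open>Adding \<open>E\<close> keeps this a window above \<open>E\<close> even for
      empty \<N>.\<close>
    have U: "\<Union>\<N> \<union> E \<in> ?\<M>" using \<N> E by auto
    obtain x where x: "x \<in> ?C (\<Union>\<N> \<union> E)" using ne[OF U] by blast
    have "x \<in> ?C M" if "M \<in> \<N>" for M
    proof -
      have "locally_bijective x M"
        by (rule locally_bijective_mono[of x "\<Union>\<N> \<union> E"]) (use x U that in auto)
      then show ?thesis using x by simp
    qed
    then show ?thesis using \<N>(3) by blast
  qed
  have "\<Inter>(?C ` ?\<M>) \<noteq> {}"
    by (rule compact_space_fip[THEN iffD1, OF compact_full_shift, rule_format])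
      (intro conjI ballI allI impI; (elim imageE conjE)?; use closed fip in simp)
  then obtain x where "x \<in> \<Inter>(?C ` ?\<M>)" by (meson ex_in_conv)
  then have x: "x \<in> ?C M" if "M \<in> ?\<M>" for M using that by (rule INT_D)
  have "E \<in> ?\<M>" using E by simp
  then have xE: "x \<in> carrier G \<rightarrow>\<^sub>E A" "restrict x E \<notin> patterns E" using x by blast+
  have "locally_bijective x M" if M: "finite M" "M \<subseteq> carrier G" for M
  proof (rule locally_bijective_mono[of x "M \<union> E"])
    have "M \<union> E \<in> ?\<M>" using M E by auto
    then show "locally_bijective x (M \<union> E)" using x by blast
  qed (use M E xE in auto)
  then have "x \<in> X" using xE by (simp add: X_iff_locally_bijective)
  then show False using xE by (auto simp: patterns_def)
qed

text \<open>The Lebesgue number lemma for cylinders: each point has a cylinder inside a member of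
  the cover, finitely many of these cylinders cover \<open>X\<close>, and the union of their windows
  serves all points.\<close>

lemma finite_open_cover_window:
  assumes "finite_open_cover (restricted_permutations_space G A) \<U>"
  obtains W where "finite W" "W \<subseteq> carrier G"
    "\<And>x. x \<in> X \<Longrightarrow> \<exists>U\<in>\<U>. \<forall>y\<in>X. restrict y W = restrict x W \<longrightarrow> y \<in> U"
proof -
  let ?S = "restricted_permutations_space G A"
  have U: "\<And>U. U \<in> \<U> \<Longrightarrow> openin ?S U" "\<Union>\<U> = X"
    using assms by (auto simp: finite_open_cover_def topspace_restricted_permutations_space)
  let ?C = "\<lambda>x W. {y \<in> X. restrict y W = restrict x W}"
  have "\<exists>W. finite W \<and> W \<subseteq> carrier G \<and> (\<exists>U\<in>\<U>. ?C x W \<subseteq> U)" if x: "x \<in> X" for x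
  proof -
    obtain u where u: "u \<in> \<U>" "x \<in> u" using U(2) x by blast
    then obtain O' where O': "openin full_shift O'" "u = O' \<inter> X"
      using U(1)[OF u(1)] by (auto simp: restricted_permutations_space_def openin_subtopology)
    then obtain V where V: "finite {i \<in> carrier G. V i \<noteq> topspace (discrete_topology A)}"
        "x \<in> Pi\<^sub>E (carrier G) V" "Pi\<^sub>E (carrier G) V \<subseteq> O'"
      using u unfolding openin_product_topology_alt by blast
    let ?W = "{i \<in> carrier G. V i \<noteq> topspace (discrete_topology A)}"
    have "y \<in> u" if y: "y \<in> X" "restrict y ?W = restrict x ?W" for y
    proof -
      have "y i \<in> V i" if i: "i \<in> carrier G" for i
      proof (cases "i \<in> ?W")
        case True
        then have "y i = x i" using fun_cong[OF y(2), of i] by simp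
        then show ?thesis using V(2) i by auto
      next
        case False
        then show ?thesis using i X_in[OF y(1) i] by simp
      qed
      then have "y \<in> Pi\<^sub>E (carrier G) V" using X_PiE y by (auto simp: PiE_iff)
      then show ?thesis using V O' y by blast
    qed
    then show ?thesis using V(1) u(1) by (intro exI[of _ ?W]) auto
  qed
  then have "\<forall>x\<in>X. \<exists>W. finite W \<and> W \<subseteq> carrier G \<and> (\<exists>U\<in>\<U>. ?C x W \<subseteq> U)" by (rule ballI)
  then obtain W where "\<forall>x\<in>X. finite (W x) \<and> W x \<subseteq> carrier G \<and> (\<exists>U\<in>\<U>. ?C x (W x) \<subseteq> U)"
    by (rule bchoice[THEN exE])
  then have W: "\<And>x. x \<in> X \<Longrightarrow> finite (W x)" "\<And>x. x \<in> X \<Longrightarrow> W x \<subseteq> carrier G"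
      "\<And>x. x \<in> X \<Longrightarrow> \<exists>U\<in>\<U>. ?C x (W x) \<subseteq> U" by simp_all
  have "openin ?S (?C x (W x))" if x: "x \<in> X" for x
  proof -
    have "?C x (W x) = {y \<in> carrier G \<rightarrow>\<^sub>E A. restrict y (W x) = restrict x (W x)} \<inter> X"
      using X_PiE by auto
    then show ?thesis
      using openin_cylinder[OF W(1,2)[OF x], of "\<lambda>y. y = restrict x (W x)"]
      by (auto simp: restricted_permutations_space_def openin_subtopology)
  qed
  moreover have "topspace ?S \<subseteq> \<Union>((\<lambda>x. ?C x (W x)) ` X)"
    by (auto simp: topspace_restricted_permutations_space)
  ultimately obtain \<F> where \<F>: "finite \<F>" "\<F> \<subseteq> (\<lambda>x. ?C x (W x)) ` X" "topspace ?S \<subseteq> \<Union>\<F>"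
    using compact_X unfolding compact_space_alt by (metis (no_types, lifting) imageE)
  obtain X0 where X0: "finite X0" "X0 \<subseteq> X" "\<F> = (\<lambda>x. ?C x (W x)) ` X0"
    using finite_subset_image[OF \<F>(1,2)] by blast
  show thesis
  proof
    show "finite (\<Union>(W ` X0))" "\<Union>(W ` X0) \<subseteq> carrier G" using X0 W by auto
    fix x assume x: "x \<in> X"
    then obtain z where z: "z \<in> X0" "x \<in> ?C z (W z)"
      using \<F>(3) X0(3) by (auto simp: topspace_restricted_permutations_space)
    then obtain u where u: "u \<in> \<U>" "?C z (W z) \<subseteq> u" using W(3) X0(2) by blast
    have "y \<in> u" if y: "y \<in> X" "restrict y (\<Union>(W ` X0)) = restrict x (\<Union>(W ` X0))" for y
    proof -
      have "y i = x i" if "i \<in> W z" for i using fun_cong[OF y(2), of i] z that by (auto split: if_splits)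
      then have "restrict y (W z) = restrict x (W z)" by (auto simp: restrict_def)
      then show ?thesis using y(1) z u by auto
    qed
    then show "\<exists>U\<in>\<U>. \<forall>y\<in>X. restrict y (\<Union>(W ` X0)) = restrict x (\<Union>(W ` X0)) \<longrightarrow> y \<in> U"
      using u(1) by blast
  qed
qed


subsection \<open>Topological entropy as a pattern entropy\<close>

text \<open>Shifting by \<open>s\<close> moves the coordinate read at \<open>\<one>\<close> to
  \<open>s\<close>. Hence joins over \<open>F\<close> read the coordinates in \<open>F\<close> and
  not in its inverse.\<close>

lemma left_shift_image_cylinder:
  assumes s: "s \<in> carrier G"
  shows "left_shift G s ` {x\<in>X. x \<one> = a} = {y\<in>X. y s = a}"
proof (intro equalityI subsetI)
  fix y assume "y \<in> left_shift G s ` {x\<in>X. x \<one> = a}"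
  then show "y \<in> {y\<in>X. y s = a}"
    using s left_shift_X by (auto simp: left_shift_def)
next
  fix y assume y: "y \<in> {y\<in>X. y s = a}"
  then have "left_shift G (inv s) y \<in> {x\<in>X. x \<one> = a}"
    using s left_shift_X[of "inv s" y] by (auto simp: left_shift_def)
  moreover have "y = left_shift G s (left_shift G (inv s) y)" using y s left_shift_inv by simp
  ultimately show "y \<in> left_shift G s ` {x\<in>X. x \<one> = a}" by blast
qed

text \<open>The cover that attains the supremum in the topological entropy.\<close>

definition coordinate_cover :: "('a \<Rightarrow> 'a) set set" where
  "coordinate_cover = (\<lambda>a. {x\<in>X. x \<one> = a}) ` A"

lemma finite_open_cover_coordinate_cover:
  "finite_open_cover (restricted_permutations_space G A) coordinate_cover"
  unfolding finite_open_cover_def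
proof (intro conjI ballI)
  fix U assume "U \<in> coordinate_cover"
  then obtain a where a: "U = {x\<in>X. x \<one> = a}" by (auto simp: coordinate_cover_def)
  have "U = {x \<in> carrier G \<rightarrow>\<^sub>E A. restrict x {\<one>} \<one> = a} \<inter> X" using a X_PiE by auto
  then show "openin (restricted_permutations_space G A) U"
    using openin_cylinder[of "{\<one>}" "\<lambda>y. y \<one> = a"]
    unfolding restricted_permutations_space_def openin_subtopology by blast
qed (use A_fin X_in in \<open>auto simp: coordinate_cover_def topspace_restricted_permutations_space\<close>)

text \<open>Distinct members of the join are disjoint cylinders over \<open>F\<close>, so a subcover
  has to contain every nonempty one, and these correspond to the patterns.\<close>

lemma min_subcover_card_coordinate_cover:
  assumes F: "finite F" "F \<noteq> {}" "F \<subseteq> carrier G"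
  shows "min_subcover_card (restricted_permutations_space G A)
    (translated_join (left_shift G) F coordinate_cover) = card (patterns F)"
  unfolding min_subcover_card_def topspace_restricted_permutations_space
proof (rule Least_equality)
  \<comment> \<open>The join is indexed by \<open>F \<rightarrow> A\<close>, whose members are
    arbitrary off \<open>F\<close>; therefore \<open>p\<close> is restricted.\<close>
  define cyl where "cyl p = {y\<in>X. restrict y F = restrict p F}" for p :: "'a \<Rightarrow> 'a"
  have join: "translated_join (left_shift G) F coordinate_cover = cyl ` (F \<rightarrow> A)"
  proof (intro equalityI subsetI)
    have cyl: "(\<Inter>s\<in>F. left_shift G s ` {x\<in>X. x \<one> = p s}) = cyl p" for p
    proof -
      have "(\<Inter>s\<in>F. left_shift G s ` {x\<in>X. x \<one> = p s}) = (\<Inter>s\<in>F. {y\<in>X. y s = p s})"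
        using F by (intro INF_cong refl left_shift_image_cylinder) auto
      also have "\<dots> = cyl p"
        using F(2) by (auto simp: cyl_def restrict_def fun_eq_iff)
      finally show ?thesis .
    qed
    fix V
    {
      assume "V \<in> translated_join (left_shift G) F coordinate_cover"
      then obtain u where u: "V = (\<Inter>s\<in>F. left_shift G s ` u s)" "u \<in> F \<rightarrow> coordinate_cover"
        by (auto simp: translated_join_def)
      then have "\<forall>s\<in>F. \<exists>a. a \<in> A \<and> u s = {x\<in>X. x \<one> = a}" by (auto simp: coordinate_cover_def Pi_iff)
      then obtain p where p: "\<forall>s\<in>F. p s \<in> A \<and> u s = {x\<in>X. x \<one> = p s}" by (rule bchoice[THEN exE])
      then have "V = (\<Inter>s\<in>F. left_shift G s ` {x\<in>X. x \<one> = p s})" using u(1) by simp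
      then show "V \<in> cyl ` (F \<rightarrow> A)" using p by (auto simp: cyl)
    next
      assume "V \<in> cyl ` (F \<rightarrow> A)"
      then obtain p where "V = cyl p" "p \<in> F \<rightarrow> A" by blast
      then show "V \<in> translated_join (left_shift G) F coordinate_cover"
        unfolding translated_join_def cyl[symmetric]
        by (intro CollectI exI[of _ "\<lambda>s. {x\<in>X. x \<one> = p s}"]) (auto simp: coordinate_cover_def)
    }
  qed
  have pat: "patterns F \<subseteq> F \<rightarrow> A" using patterns_PiE[OF F(3)] by auto
  have restrict_pat: "restrict p F = p" if "p \<in> patterns F" for p
    using that by (auto simp: patterns_def)
  have "inj_on cyl (patterns F)"
  proof (rule inj_onI)
    fix p q assume pq: "p \<in> patterns F" "q \<in> patterns F" "cyl p = cyl q"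
    then obtain x where x: "x \<in> X" "p = restrict x F" by (auto simp: patterns_def)
    then have "x \<in> cyl p" by (simp add: cyl_def)
    then have "x \<in> cyl q" using pq(3) by simp
    then have "restrict x F = restrict q F" by (simp add: cyl_def)
    then show "p = q" using x(2) restrict_pat[OF pq(2)] by simp
  qed
  then have "card (cyl ` patterns F) = card (patterns F)" by (rule card_image)
  moreover have "\<Union>(cyl ` patterns F) = X"
  proof
    show "\<Union>(cyl ` patterns F) \<subseteq> X" by (auto simp: cyl_def)
    have "x \<in> cyl (restrict x F)" if "x \<in> X" for x using that by (simp add: cyl_def)
    then show "X \<subseteq> \<Union>(cyl ` patterns F)" unfolding patterns_def by blast
  qed
  ultimately show "\<exists>\<V>\<subseteq>translated_join (left_shift G) F coordinate_cover.
      finite \<V> \<and> card \<V> = card (patterns F) \<and> \<Union>\<V> = X"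
    using pat finite_patterns[OF F(1,3)] unfolding join by (intro exI[of _ "cyl ` patterns F"]) auto
  fix n assume "\<exists>\<V>\<subseteq>translated_join (left_shift G) F coordinate_cover.
      finite \<V> \<and> card \<V> = n \<and> \<Union>\<V> = X"
  then obtain \<V> where \<V>: "\<V> \<subseteq> cyl ` (F \<rightarrow> A)" "finite \<V>" "card \<V> = n" "\<Union>\<V> = X"
    unfolding join by blast
  \<comment> \<open>All points of a cylinder share one pattern on \<open>F\<close>, so any chosen
    point of \<open>V\<close> recovers it.\<close>
  have "patterns F \<subseteq> (\<lambda>V. restrict (SOME x. x \<in> V) F) ` \<V>"
  proof
    fix p assume "p \<in> patterns F"
    then obtain x where x: "x \<in> X" "p = restrict x F" by (auto simp: patterns_def)
    then obtain V where V: "V \<in> \<V>" "x \<in> V" using \<V>(4) by blast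
    then obtain q where q: "V = cyl q" using \<V>(1) by blast
    have "(SOME x. x \<in> V) \<in> V" using V(2) by (rule someI[of "\<lambda>x. x \<in> V"])
    then have "p = restrict (SOME x. x \<in> V) F" using V(2) x(2) by (simp add: q cyl_def)
    then show "p \<in> (\<lambda>V. restrict (SOME x. x \<in> V) F) ` \<V>" using V(1) by (rule image_eqI)
  qed
  then show "card (patterns F) \<le> n" using surj_card_le[OF \<V>(2)] \<V>(3) by blast
qed

text \<open>One member of the join per pattern on \<open>F <#> W\<close> suffices. If
  \<open>y\<close> agrees with \<open>x\<close> on \<open>F <#> W\<close>, then for each
  \<open>s\<close> in \<open>F\<close> their shifts by \<open>inv s\<close> agree on
  \<open>W\<close>, so the member of \<U> chosen for the shift of \<open>x\<close> also contains
  that of \<open>y\<close>.\<close>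

lemma min_subcover_card_le:
  assumes F: "finite F" "F \<noteq> {}" "F \<subseteq> carrier G" and W: "finite W" "W \<subseteq> carrier G"
    and \<U>: "\<Union>\<U> \<subseteq> X" and window: "\<And>x. x \<in> X \<Longrightarrow> \<exists>U\<in>\<U>. \<forall>y\<in>X. restrict y W = restrict x W \<longrightarrow> y \<in> U"
  shows "min_subcover_card (restricted_permutations_space G A)
    (translated_join (left_shift G) F \<U>) \<le> card (patterns (F <#> W))"
proof -
  let ?P = "patterns (F <#> W)"
  have FW: "finite (F <#> W)" "F <#> W \<subseteq> carrier G"
    using F W by (auto simp: finite_set_mult set_mult_closed)
  have "\<forall>x\<in>X. \<exists>U. U \<in> \<U> \<and> (\<forall>y\<in>X. restrict y W = restrict x W \<longrightarrow> y \<in> U)" using window by blast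
  then obtain u where u: "\<And>x. x \<in> X \<Longrightarrow> u x \<in> \<U>"
      "\<And>x y. x \<in> X \<Longrightarrow> y \<in> X \<Longrightarrow> restrict y W = restrict x W \<Longrightarrow> y \<in> u x"
    by (elim bchoice[THEN exE]) blast
  define J where "J x = (\<Inter>s\<in>F. left_shift G s ` u (left_shift G (inv s) x))" for x
  have shift: "left_shift G (inv s) x \<in> X" if "s \<in> F" "x \<in> X" for s x
    using that F by (intro left_shift_X) auto
  have JX: "J x \<subseteq> X" if "x \<in> X" for x
  proof -
    obtain s where s: "s \<in> F" "s \<in> carrier G" using F by blast
    have "u (left_shift G (inv s) x) \<subseteq> X" using u(1) shift s that \<U> by blast
    then show ?thesis unfolding J_def using s left_shift_X by blast
  qed
  have J_in: "y \<in> J x" if xy: "x \<in> X" "y \<in> X" "restrict y (F <#> W) = restrict x (F <#> W)" for x y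
    unfolding J_def
  proof
    fix s assume s: "s \<in> F"
    then have sc: "s \<in> carrier G" using F by auto
    have "restrict (left_shift G (inv s) y) W = restrict (left_shift G (inv s) x) W"
    proof
      fix t
      show "restrict (left_shift G (inv s) y) W t = restrict (left_shift G (inv s) x) W t"
      proof (cases "t \<in> W")
        case True
        then have "s \<otimes> t \<in> F <#> W" using s by (auto simp: set_mult_def)
        then have "y (s \<otimes> t) = x (s \<otimes> t)" using fun_cong[OF xy(3), of "s \<otimes> t"] by simp
        then show ?thesis using True sc W by (auto simp: left_shift_def)
      qed simp
    qed
    then have "left_shift G (inv s) y \<in> u (left_shift G (inv s) x)"
      using shift s xy by (intro u(2)) auto
    then show "y \<in> left_shift G s ` u (left_shift G (inv s) x)"
      using left_shift_inv[OF sc xy(2)] by (metis image_eqI)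
  qed
  define r where "r p = (SOME x. x \<in> X \<and> restrict x (F <#> W) = p)" for p
  have r: "r p \<in> X \<and> restrict (r p) (F <#> W) = p" if "p \<in> ?P" for p
  proof -
    have "\<exists>x. x \<in> X \<and> restrict x (F <#> W) = p" using that by (auto simp: patterns_def)
    then show ?thesis unfolding r_def by (rule someI_ex)
  qed
  let ?\<V> = "(\<lambda>p. J (r p)) ` ?P"
  have "?\<V> \<subseteq> translated_join (left_shift G) F \<U>"
  proof clarify
    fix p assume "p \<in> ?P"
    then show "J (r p) \<in> translated_join (left_shift G) F \<U>"
      unfolding translated_join_def J_def using r u(1) shift
      by (intro CollectI exI[of _ "\<lambda>s. u (left_shift G (inv s) (r p))"]) auto
  qed
  moreover have "\<Union>?\<V> = X"
  proof
    show "\<Union>?\<V> \<subseteq> X" using JX r by blast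
    show "X \<subseteq> \<Union>?\<V>"
    proof
      fix x assume x: "x \<in> X"
      then have p: "restrict x (F <#> W) \<in> ?P" by (auto simp: patterns_def)
      then have "x \<in> J (r (restrict x (F <#> W)))" using r[OF p] x by (intro J_in) auto
      then show "x \<in> \<Union>?\<V>" using p by blast
    qed
  qed
  ultimately have "min_subcover_card (restricted_permutations_space G A)
      (translated_join (left_shift G) F \<U>) \<le> card ?\<V>"
    unfolding min_subcover_card_def topspace_restricted_permutations_space
    using finite_patterns[OF FW] by (intro Least_le exI[of _ ?\<V>]) auto
  also have "\<dots> \<le> card ?P" using finite_patterns[OF FW] by (rule card_image_le)
  finally show ?thesis .
qed

lemma card_A_ge_1: "1 \<le> card A"
  using A_fin A_ne by (simp add: Suc_le_eq card_gt_0_iff)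

text \<open>The joins need at most as many sets as there are patterns on \<open>F <#> K\<close>, and
  the coordinates beyond \<open>F\<close> cost a factor \<open>card A\<close> each, which is
  negligible for almost invariant \<open>F\<close>. Amenability makes the filter proper, so that
  limits can be compared.\<close>

lemma cover_entropy_le:
  assumes "amenable G" and \<U>: "finite_open_cover (restricted_permutations_space G A) \<U>"
    and l: "((\<lambda>F. ln (real (min_subcover_card (restricted_permutations_space G A)
       (translated_join (left_shift G) F \<U>))) / real (card F)) \<longlongrightarrow> l) (right_invariant G)"
      (is "(?\<phi> \<longlongrightarrow> l) _")
  shows "l \<le> entropy_rate"
proof (rule field_le_epsilon)
  fix \<eta> :: real assume "\<eta> > 0"
  obtain W where W: "finite W" "W \<subseteq> carrier G"
    "\<And>x. x \<in> X \<Longrightarrow> \<exists>U\<in>\<U>. \<forall>y\<in>X. restrict y W = restrict x W \<longrightarrow> y \<in> U"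
    using finite_open_cover_window[OF \<U>] by blast
  \<comment> \<open>The identity is added to get \<open>F \<subseteq> F <#> K\<close>.\<close>
  define K where "K = insert \<one> W"
  have K: "finite K" "K \<subseteq> carrier G" "\<one> \<in> K" using W by (auto simp: K_def)
  have window: "\<exists>U\<in>\<U>. \<forall>y\<in>X. restrict y K = restrict x K \<longrightarrow> y \<in> U" if x: "x \<in> X" for x
  proof -
    have "restrict y W = restrict x W" if "restrict y K = restrict x K" for y
      using fun_cong[OF that] by (auto simp: K_def restrict_def fun_eq_iff) metis
    then show ?thesis using W(3)[OF x] by blast
  qed
  have \<U>X: "\<Union>\<U> \<subseteq> X"
    using \<U> by (simp add: finite_open_cover_def topspace_restricted_permutations_space)
  define c where "c = ln (real (card A))"
  have c: "0 \<le> c" using card_A_ge_1 by (simp add: c_def)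
  define \<delta> where "\<delta> = \<eta> / (c + 1)"
  have \<delta>: "0 < \<delta>" "\<delta> * c \<le> \<eta>" using c \<open>\<eta> > 0\<close> by (auto simp: \<delta>_def field_simps)
  have "?\<phi> F \<le> ln (real (card (patterns F))) / real (card F) + \<eta>" if "F \<in> right_invariant_sets G K \<delta>" for F
  proof -
    have F: "finite F" "F \<noteq> {}" "F \<subseteq> carrier G" and
      inv: "real (card (sym_diff (F <#> K) F)) < \<delta> * real (card F)"
      using that by (auto simp: right_invariant_sets_def)
    have cF: "0 < real (card F)" using F by (simp add: card_gt_0_iff)
    have FK: "finite (F <#> K)" "F <#> K \<subseteq> carrier G"
      using F K by (auto simp: finite_set_mult set_mult_closed)
    have "f \<in> F <#> K" if "f \<in> F" for f
    proof -
      have "f = f \<otimes> \<one>" using that F by auto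
      then show ?thesis unfolding set_mult_def using that K by blast
    qed
    then have sub: "F \<subseteq> F <#> K" by blast
    define m where "m = min_subcover_card (restricted_permutations_space G A)
       (translated_join (left_shift G) F \<U>)"
    have "m \<le> card (patterns (F <#> K))"
      unfolding m_def using min_subcover_card_le[OF F K(1,2) \<U>X window] by simp
    also have "\<dots> \<le> card ((\<lambda>y. restrict y F) ` patterns (F <#> K)) * card A ^ card ((F <#> K) - F)"
      by (rule card_le_card_restrict[OF FK(1) A_fin patterns_PiE[OF FK(2)] sub])
    also have "\<dots> = card (patterns F) * card A ^ card ((F <#> K) - F)" using sub by (simp add: restrict_patterns)
    finally have m: "m \<le> card (patterns F) * card A ^ card ((F <#> K) - F)" .
    have pos: "1 \<le> card (patterns F)" using card_patterns_ge_1 F by simp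
    have "ln (real m) \<le> ln (real (card (patterns F))) + card ((F <#> K) - F) * c"
    proof (cases "m = 0")
      \<comment> \<open>Here \<open>ln 0 = 0\<close>, and the right-hand side is
        nonnegative.\<close>
      case True
      then show ?thesis using pos c by simp
    next
      case False
      then have "ln (real m) \<le> ln (real (card (patterns F) * card A ^ card ((F <#> K) - F)))"
        using m by (intro ln_mono) (auto simp only: of_nat_0_less_iff of_nat_le_iff)
      also have "\<dots> = ln (real (card (patterns F))) + card ((F <#> K) - F) * c"
        using pos card_A_ge_1 by (simp add: ln_mult ln_realpow c_def)
      finally show ?thesis .
    qed
    also have "real (card ((F <#> K) - F)) * c \<le> \<delta> * card F * c"
    proof (rule mult_right_mono[OF _ c])
      have "card ((F <#> K) - F) \<le> card (sym_diff (F <#> K) F)" using F FK by (intro card_mono) auto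
      then show "real (card ((F <#> K) - F)) \<le> \<delta> * card F" using inv by linarith
    qed
    also have "\<delta> * card F * c \<le> \<eta> * card F" using \<delta>(2) cF by (simp add: mult.commute mult.left_commute)
    finally have "ln (real m) / card F \<le> (ln (real (card (patterns F))) + \<eta> * card F) / card F"
      using cF by (intro divide_right_mono) auto
    then show ?thesis using cF by (simp add: m_def add_divide_distrib)
  qed
  then have "eventually (\<lambda>F. ?\<phi> F \<le> ln (real (card (patterns F))) / real (card F) + \<eta>) (right_invariant G)"
    unfolding eventually_right_invariant[OF group_axioms]
    using K \<delta>(1) by (intro exI[of _ K] exI[of _ \<delta>]) auto
  moreover have "right_invariant G \<noteq> bot"
    using assms(1) amenable_iff_right_invariant_nontrivial[OF group_axioms] by simp
  ultimately show "l \<le> entropy_rate + \<eta>"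
    using l by (intro tendsto_le[OF _ tendsto_add[OF entropy_rate_limit tendsto_const]])
qed

text \<open>The coordinate cover yields \<open>entropy_rate\<close> itself, and by
  \<open>cover_entropy_le\<close> no cover yields more.\<close>

theorem h_top_eq_entropy_rate:
  assumes "amenable G"
  shows "h_top G A = ereal entropy_rate"
  unfolding h_top_def topological_entropy_def
proof (rule antisym)
  let ?S = "restricted_permutations_space G A"
  have "((\<lambda>F. ln (real (min_subcover_card ?S (translated_join (left_shift G) F coordinate_cover))) /
      real (card F)) \<longlongrightarrow> entropy_rate) (right_invariant G)"
  proof (rule Lim_transform_eventually[OF entropy_rate_limit])
    show "eventually (\<lambda>F. ln (real (card (patterns F))) / real (card F) =
      ln (real (min_subcover_card ?S (translated_join (left_shift G) F coordinate_cover))) / real (card F))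
      (right_invariant G)"
      unfolding eventually_right_invariant[OF group_axioms]
      by (intro exI[of _ "{\<one>}"] exI[of _ 1])
        (auto simp: min_subcover_card_coordinate_cover right_invariant_sets_def)
  qed
  then show "ereal entropy_rate \<le> Sup {ereal l | l \<U>. finite_open_cover ?S \<U> \<and>
       ((\<lambda>F. ln (real (min_subcover_card ?S (translated_join (left_shift G) F \<U>))) / real (card F))
          \<longlongrightarrow> l) (right_invariant G)}"
    using finite_open_cover_coordinate_cover by (intro Sup_upper) blast
qed (use cover_entropy_le[OF assms] in \<open>auto intro!: Sup_least\<close>)

end

subsection \<open>The lower bound\<close>

text \<open>For fixed \<open>l\<close>, right multiplication by \<open>l\<close> sends the points
  that it moves out of \<open>F\<close> injectively into the symmetric difference.\<close>

lemma (in group) card_right_boundary_le: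
  assumes F: "finite F" "F \<subseteq> carrier G" and L: "finite L" "L \<subseteq> carrier G"
  shows "card {f\<in>F. \<exists>l\<in>L. f \<otimes> l \<notin> F} \<le> card L * card (sym_diff (F <#> L) F)"
proof -
  have "{f\<in>F. \<exists>l\<in>L. f \<otimes> l \<notin> F} = (\<Union>l\<in>L. {f\<in>F. f \<otimes> l \<notin> F})" by blast
  then have "card {f\<in>F. \<exists>l\<in>L. f \<otimes> l \<notin> F} \<le> (\<Sum>l\<in>L. card {f\<in>F. f \<otimes> l \<notin> F})"
    using card_UN_le[OF L(1), of "\<lambda>l. {f\<in>F. f \<otimes> l \<notin> F}"] by simp
  also have "\<dots> \<le> (\<Sum>l\<in>L. card (sym_diff (F <#> L) F))"
  proof (rule sum_mono)
    fix l assume l: "l \<in> L"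
    then have lc: "l \<in> carrier G" using L by auto
    have "inj_on (\<lambda>f. f \<otimes> l) {f\<in>F. f \<otimes> l \<notin> F}"
      using F lc by (auto intro!: inj_onI simp: subset_iff)
    moreover have "(\<lambda>f. f \<otimes> l) ` {f\<in>F. f \<otimes> l \<notin> F} \<subseteq> sym_diff (F <#> L) F"
      using l by (auto simp: set_mult_def)
    ultimately show "card {f\<in>F. f \<otimes> l \<notin> F} \<le> card (sym_diff (F <#> L) F)"
      using F L by (intro card_inj_on_le) (auto simp: finite_set_mult)
  qed
  finally show ?thesis by simp
qed

context finite_alphabet
begin

text \<open>A row sum of the relation \<open>inv s \<otimes> t \<in> A\<close> on \<open>F\<close>,
  rewritten so that it falls short of \<open>card A\<close> by the number of letters that lead out
  of \<open>F\<close>. \<open>card_preimages_in\<close> does this for the columns.\<close>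

lemma card_quotients_in:
  assumes "s \<in> carrier G" "F \<subseteq> carrier G"
  shows "card {t\<in>F. inv s \<otimes> t \<in> A} = card {a\<in>A. s \<otimes> a \<in> F}"
proof (rule bij_betw_same_card[of "\<lambda>t. inv s \<otimes> t"])
  have *: "inv s \<otimes> (s \<otimes> a) = a" "s \<otimes> (inv s \<otimes> a) = a" if "a \<in> carrier G" for a
    using assms that by (simp_all flip: m_assoc)
  show "bij_betw (\<lambda>t. inv s \<otimes> t) {t\<in>F. inv s \<otimes> t \<in> A} {a\<in>A. s \<otimes> a \<in> F}"
    using assms A_sub by (intro bij_betw_byWitness[where f' = "\<lambda>a. s \<otimes> a"]) (auto simp: * subset_iff)
qed

lemma card_preimages_in:
  assumes "t \<in> carrier G" "F \<subseteq> carrier G"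
  shows "card {s\<in>F. inv s \<otimes> t \<in> A} = card {a\<in>A. t \<otimes> inv a \<in> F}"
proof (rule bij_betw_same_card[of "\<lambda>s. inv s \<otimes> t"])
  have *: "t \<otimes> inv (inv s \<otimes> t) = s" "inv (t \<otimes> inv s) \<otimes> t = s" if "s \<in> carrier G" for s
    using assms that by (simp_all add: inv_mult_group m_assoc) (simp_all flip: m_assoc)
  show "bij_betw (\<lambda>s. inv s \<otimes> t) {s\<in>F. inv s \<otimes> t \<in> A} {a\<in>A. t \<otimes> inv a \<in> F}"
    using assms A_sub by (intro bij_betw_byWitness[where f' = "\<lambda>a. t \<otimes> inv a"]) (auto simp: * subset_iff)
qed

text \<open>
  The 0-1 matrix of the relation \<open>inv s \<otimes> t \<in> A\<close> on \<open>F \<times> F\<close> has row and column sums at most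
  \<open>card A\<close>. Adding the product of the row and column defects, divided by the total defect,
  makes all sums equal to \<open>card A\<close> and only changes rows and columns with a defect.
\<close>

lemma many_locally_bijective_patterns:
  assumes F: "finite F" "F \<subseteq> carrier G"
  defines "F' \<equiv> {s\<in>F. \<forall>a\<in>A. s \<otimes> a \<in> F}"
  shows "\<exists>Y \<subseteq> F' \<rightarrow>\<^sub>E A. (\<forall>y\<in>Y. locally_bijective y F') \<and>
    (card A / exp 1) ^ card F \<le> card Y * real (card A) ^ card (F - F')"
proof -
  define d where "d = real (card A)"
  have d: "0 < d" using card_A_ge_1 by (simp add: d_def)
  define B where "B s t = (if inv s \<otimes> t \<in> A then 1 else 0 :: real)" for s t
  define row where "row s = d - (\<Sum>t\<in>F. B s t)" for s
  define col where "col t = d - (\<Sum>s\<in>F. B s t)" for t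
  define D where "D = (\<Sum>s\<in>F. row s)"
  have sumB: "(\<Sum>t\<in>F. B s t) = real (card {t\<in>F. inv s \<otimes> t \<in> A})"
    "(\<Sum>s\<in>F. B s t) = real (card {s\<in>F. inv s \<otimes> t \<in> A})" for s t
    using F by (simp_all add: B_def sum.If_cases Int_def)
  have row0: "0 \<le> row s" if "s \<in> F" for s
  proof -
    have "card {a\<in>A. s \<otimes> a \<in> F} \<le> card A" using A_fin by (intro card_mono) auto
    then show ?thesis using that F card_quotients_in[of s F] by (auto simp: row_def sumB d_def)
  qed
  have col0: "0 \<le> col t" if "t \<in> F" for t
  proof -
    have "card {a\<in>A. t \<otimes> inv a \<in> F} \<le> card A" using A_fin by (intro card_mono) auto
    then show ?thesis using that F card_preimages_in[of t F] by (auto simp: col_def sumB d_def)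
  qed
  have row_F': "row s = 0" if "s \<in> F'" for s
  proof -
    have "{a\<in>A. s \<otimes> a \<in> F} = A" using that by (auto simp: F'_def)
    then show ?thesis using that F card_quotients_in[of s F] by (auto simp: row_def sumB d_def F'_def)
  qed
  have col_F: "col t = 0" if "t \<in> F" "(\<lambda>a. t \<otimes> inv a) ` A \<subseteq> F" for t
  proof -
    have "{a\<in>A. t \<otimes> inv a \<in> F} = A" using that by auto
    then show ?thesis using that F card_preimages_in[of t F] by (auto simp: col_def sumB d_def)
  qed
  have D_col: "D = (\<Sum>t\<in>F. col t)"
    unfolding D_def row_def col_def sum_subtractf by (subst sum.swap) simp
  have D0: "0 \<le> D" unfolding D_def using row0 by (intro sum_nonneg)
  \<comment> \<open>If \<open>D = 0\<close>, all defects vanish, and division by zero makes the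
    correction 0 as it should be.\<close>
  define b where "b s t = (B s t + row s * col t / D) / d" for s t
  have b0: "0 \<le> b s t" if "s \<in> F" "t \<in> F" for s t
    using that row0 col0 D0 d by (simp add: b_def B_def)
  have rowsum: "(\<Sum>t\<in>F. b s t) = 1" if "s \<in> F" for s
  proof -
    have "row s = 0" if "D = 0"
      using that \<open>s \<in> F\<close> row0 F by (simp add: D_def sum_nonneg_eq_0_iff)
    then have "(\<Sum>t\<in>F. row s * col t / D) = row s"
      by (cases "D = 0") (simp_all add: D_col flip: sum_divide_distrib sum_distrib_left)
    then show ?thesis using d by (simp add: b_def sum.distrib row_def flip: sum_divide_distrib)
  qed
  have colsum: "(\<Sum>s\<in>F. b s t) = 1" if "t \<in> F" for t
  proof -
    have "col t = 0" if "D = 0"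
      using that \<open>t \<in> F\<close> col0 F by (simp add: D_col sum_nonneg_eq_0_iff)
    then have "(\<Sum>s\<in>F. row s * col t / D) = col t"
      by (cases "D = 0") (simp_all add: D_def flip: sum_divide_distrib sum_distrib_right)
    then show ?thesis using d by (simp add: b_def sum.distrib col_def flip: sum_divide_distrib)
  qed
  have F'F: "F' \<subseteq> F" by (auto simp: F'_def)
  define \<Phi> where "\<Phi> = {\<sigma>\<in>injections F F. \<forall>s\<in>F. b s (\<sigma> s) \<noteq> 0}"
  have fin\<Phi>: "finite \<Phi>" using F by (simp add: \<Phi>_def finite_injections)
  \<comment> \<open>Only rows in \<open>F'\<close> are read: outside \<open>F'\<close> the
    correction may be positive, and then \<open>\<sigma> s\<close> need not be reached from
    \<open>s\<close> by a letter of \<open>A\<close>.\<close>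
  define pat where "pat \<sigma> = (\<lambda>s\<in>F'. inv s \<otimes> \<sigma> s)" for \<sigma> :: "'a \<Rightarrow> 'a"
  define Y where "Y = pat ` \<Phi>"
  have finY: "finite Y" using fin\<Phi> by (simp add: Y_def)
  have \<sigma>_F: "\<sigma> s \<in> F" "\<sigma> s \<in> carrier G" if "\<sigma> \<in> \<Phi>" "s \<in> F" for \<sigma> s
    using that F by (auto simp: \<Phi>_def injections_def)
  have pat_A: "inv s \<otimes> \<sigma> s \<in> A" if "\<sigma> \<in> \<Phi>" "s \<in> F'" for \<sigma> s
  proof -
    have "b s (\<sigma> s) \<noteq> 0" using that F'F by (auto simp: \<Phi>_def)
    then show ?thesis using row_F'[OF that(2)] by (simp add: b_def B_def split: if_splits)
  qed
  have pat_mult: "s \<otimes> pat \<sigma> s = \<sigma> s" if "\<sigma> \<in> \<Phi>" "s \<in> F'" for \<sigma> s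
  proof -
    have "s \<in> carrier G" using that F'F F by auto
    moreover have "\<sigma> s \<in> carrier G" using that \<sigma>_F F'F by auto
    ultimately show ?thesis using that by (simp add: pat_def flip: m_assoc)
  qed
  have 1: "Y \<subseteq> F' \<rightarrow>\<^sub>E A" using pat_A by (auto simp: Y_def pat_def)
  have 2: "locally_bijective y F'" if y: "y \<in> Y" for y
  proof -
    obtain \<sigma> where \<sigma>: "\<sigma> \<in> \<Phi>" "y = pat \<sigma>" using y by (auto simp: Y_def)
    have inj: "inj_on \<sigma> F" using \<sigma>(1) by (auto simp: \<Phi>_def injections_def)
    have surj: "\<sigma> ` F = F"
      using \<sigma>(1) inj F by (intro endo_inj_surj) (auto simp: \<Phi>_def injections_def)
    have "inj_on (\<lambda>s. s \<otimes> y s) F' = inj_on \<sigma> F'"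
      using \<sigma> pat_mult by (intro inj_on_cong) auto
    moreover have "t \<in> (\<lambda>s. s \<otimes> y s) ` F'" if t: "t \<in> carrier G" "(\<lambda>a. t \<otimes> inv a) ` A \<subseteq> F'" for t
    proof -
      obtain a where a: "a \<in> A" "a \<in> carrier G" using A_ne A_sub by auto
      have "t \<otimes> inv a \<in> F'" using a t by auto
      then have "(t \<otimes> inv a) \<otimes> a \<in> F" using a by (auto simp: F'_def)
      then have tF: "t \<in> F" using a t by (simp add: m_assoc)
      then obtain s where s: "s \<in> F" "t = \<sigma> s" using surj by blast
      \<comment> \<open>A column without defect carries no correction, so \<open>t\<close> is
        reached from \<open>s\<close> by a letter. Thus \<open>s\<close> is one of the
        \<open>t \<otimes> inv a\<close>, all of which lie in \<open>F'\<close>.\<close>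
      have "col t = 0" using t F'F by (intro col_F tF) auto
      then have "B s t \<noteq> 0" using s \<sigma>(1) by (auto simp: \<Phi>_def b_def)
      then have "inv s \<otimes> t \<in> A" by (simp add: B_def split: if_splits)
      moreover have "t \<otimes> inv (inv s \<otimes> t) = s"
      proof -
        have "s \<in> carrier G" using s F by auto
        then show ?thesis using t(1) by (simp add: inv_mult_group flip: m_assoc)
      qed
      ultimately have "s \<in> F'" using t(2) by force
      then show ?thesis using pat_mult[OF \<sigma>(1)] \<sigma>(2) s(2) by force
    qed
    ultimately show ?thesis
      unfolding locally_bijective_def using inj_on_subset[OF inj F'F] by blast
  qed
  \<comment> \<open>On \<open>F'\<close> all entries used equal \<open>1 / d\<close>, and
    \<open>y\<close> determines \<sigma> there. Dropping injectivity off \<open>F'\<close> bounds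
    the rest by a product of row sums, which is 1.\<close>
  have fibre: "(\<Sum>\<sigma>\<in>{\<sigma>\<in>\<Phi>. pat \<sigma> = y}. \<Prod>s\<in>F. b s (\<sigma> s)) \<le> (1 / d) ^ card F'" for y
  proof -
    let ?S = "{\<sigma>\<in>\<Phi>. pat \<sigma> = y}"
    have prod_eq: "(\<Prod>s\<in>F. b s (\<sigma> s)) = (1 / d) ^ card F' * (\<Prod>s\<in>F - F'. b s (\<sigma> s))" if "\<sigma> \<in> \<Phi>" for \<sigma>
    proof -
      have "b s (\<sigma> s) = 1 / d" if "s \<in> F'" for s
        using pat_A[OF \<open>\<sigma> \<in> \<Phi>\<close> that] row_F'[OF that] by (simp add: b_def B_def)
      then have "(\<Prod>s\<in>F'. b s (\<sigma> s)) = (1 / d) ^ card F'" by simp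
      then show ?thesis using prod.subset_diff[OF F'F F(1), of "\<lambda>s. b s (\<sigma> s)"] by simp
    qed
    have inj: "inj_on (\<lambda>\<sigma>. restrict \<sigma> (F - F')) ?S"
    proof (rule inj_onI)
      fix \<sigma> \<tau> assume st: "\<sigma> \<in> ?S" "\<tau> \<in> ?S" "restrict \<sigma> (F - F') = restrict \<tau> (F - F')"
      have "\<sigma> s = \<tau> s" if "s \<in> F" for s
      proof (cases "s \<in> F'")
        case True
        have "\<sigma> \<in> \<Phi>" "\<tau> \<in> \<Phi>" "pat \<sigma> = pat \<tau>" using st(1,2) by simp_all
        then show ?thesis using pat_mult[of \<sigma> s] pat_mult[of \<tau> s] True by simp
      next
        case False
        then show ?thesis using fun_cong[OF st(3), of s] that by simp
      qed
      moreover have "\<sigma> \<in> F \<rightarrow>\<^sub>E F" "\<tau> \<in> F \<rightarrow>\<^sub>E F" using st by (auto simp: \<Phi>_def injections_def)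
      ultimately show "\<sigma> = \<tau>" by (intro PiE_ext)
    qed
    have "(\<Sum>\<sigma>\<in>?S. \<Prod>s\<in>F. b s (\<sigma> s)) = (1 / d) ^ card F' * (\<Sum>\<sigma>\<in>?S. \<Prod>s\<in>F - F'. b s (restrict \<sigma> (F - F') s))"
      using prod_eq by (simp add: sum_distrib_left)
    also have "(\<Sum>\<sigma>\<in>?S. \<Prod>s\<in>F - F'. b s (restrict \<sigma> (F - F') s))
        = (\<Sum>\<tau>\<in>(\<lambda>\<sigma>. restrict \<sigma> (F - F')) ` ?S. \<Prod>s\<in>F - F'. b s (\<tau> s))"
      by (subst sum.reindex[OF inj]) simp
    also have "\<dots> \<le> (\<Sum>\<tau>\<in>(F - F') \<rightarrow>\<^sub>E F. \<Prod>s\<in>F - F'. b s (\<tau> s))"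
    proof (rule sum_mono2)
      show "finite ((F - F') \<rightarrow>\<^sub>E F)" using F by (intro finite_PiE) auto
      show "(\<lambda>\<sigma>. restrict \<sigma> (F - F')) ` ?S \<subseteq> (F - F') \<rightarrow>\<^sub>E F"
        using \<sigma>_F(1) by (auto split: if_splits)
      fix \<tau> assume "\<tau> \<in> ((F - F') \<rightarrow>\<^sub>E F) - (\<lambda>\<sigma>. restrict \<sigma> (F - F')) ` ?S"
      then have "\<tau> \<in> (F - F') \<rightarrow>\<^sub>E F" by (rule DiffD1)
      then show "0 \<le> (\<Prod>s\<in>F - F'. b s (\<tau> s))" by (intro prod_nonneg ballI b0) auto
    qed
    also have "\<dots> = (\<Prod>s\<in>F - F'. \<Sum>t\<in>F. b s t)" using F by (intro prod_sum_PiE[symmetric]) auto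
    also have "\<dots> = 1" using rowsum by (intro prod.neutral) auto
    finally show ?thesis using d by simp
  qed
  have "exp (- real (card F)) \<le> (\<Sum>\<sigma>\<in>injections F F. \<Prod>s\<in>F. b s (\<sigma> s))"
    using F b0 rowsum colsum by (intro permanent_doubly_stochastic_ge) auto
  also have "\<dots> = (\<Sum>\<sigma>\<in>\<Phi>. \<Prod>s\<in>F. b s (\<sigma> s))"
    using F by (intro sum.mono_neutral_right) (auto simp: \<Phi>_def finite_injections)
  also have "\<dots> = (\<Sum>y\<in>Y. \<Sum>\<sigma>\<in>{\<sigma>\<in>\<Phi>. pat \<sigma> = y}. \<Prod>s\<in>F. b s (\<sigma> s))"
    using fin\<Phi> finY by (intro sum.group[symmetric]) (auto simp: Y_def)
  also have "\<dots> \<le> (\<Sum>y\<in>Y. (1 / d) ^ card F')" by (intro sum_mono fibre)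
  also have "\<dots> = card Y * (1 / d) ^ card F'" by simp
  finally have le: "exp (- real (card F)) \<le> card Y * (1 / d) ^ card F'" .
  have cF: "card F = card F' + card (F - F')"
    using F F'F by (simp add: card_Diff_subset card_mono finite_subset)
  have "exp (real (card F)) = exp 1 ^ card F" using exp_of_nat_mult[of "card F" "1::real"] by simp
  then have "(d / exp 1) ^ card F = d ^ card F * exp (- real (card F))"
    by (simp add: power_mult_distrib power_inverse exp_minus divide_inverse)
  also have "\<dots> \<le> d ^ card F * (card Y * (1 / d) ^ card F')" using le d by (intro mult_left_mono) auto
  also have "\<dots> = card Y * d ^ card (F - F')" using d by (simp add: cF power_add power_divide)
  finally have 3: "(d / exp 1) ^ card F \<le> card Y * d ^ card (F - F')" .
  show ?thesis using 1 2 3 by (auto simp: d_def)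
qed

text \<open>When \<open>g\<close> translates \<open>M\<close> into \<open>F'\<close>, a locally
  bijective pattern on \<open>F'\<close> shows on \<open>gE\<close> a translate of a pattern of
  \<open>X\<close>. Shearer's inequality over these \<open>g\<close> bounds the number of such
  patterns above, the permanent bounds it below, and the losses concern at most
  \<open>card L * \<delta> * card F\<close> boundary points.\<close>

lemma ln_div_exp_le_pattern_entropy:
  assumes "amenable G" and E: "finite E" "E \<noteq> {}" "E \<subseteq> carrier G"
  shows "ln (card A / exp 1) \<le> ln (card (patterns E)) / card E"
proof (rule field_le_epsilon)
  fix \<eta> :: real assume \<eta>: "\<eta> > 0"
  obtain M0 where M0: "finite M0" "E \<subseteq> M0" "M0 \<subseteq> carrier G"
    "\<And>x. x \<in> carrier G \<rightarrow>\<^sub>E A \<Longrightarrow> locally_bijective x M0 \<Longrightarrow> restrict x E \<in> patterns E"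
    using locally_bijective_extends[OF E(1,3)] by metis
  \<comment> \<open>With \<open>\<one>\<close> in \<open>M\<close>, having
    \<open>f \<otimes> inv e \<otimes> m \<in> F'\<close> for all \<open>m\<close> includes
    \<open>f \<otimes> inv e \<in> F'\<close>, as \<open>G0\<close> demands.\<close>
  define M where "M = insert \<one> M0"
  have M: "finite M" "E \<subseteq> M" "M \<subseteq> carrier G" "\<one> \<in> M" using M0 by (auto simp: M_def)
  have extends: "restrict x E \<in> patterns E"
    if "x \<in> carrier G \<rightarrow>\<^sub>E A" "locally_bijective x M" for x
  proof (rule M0(4)[OF that(1)])
    show "locally_bijective x M0"
      by (rule locally_bijective_mono[OF that(2)]) (use M that(1) in \<open>auto simp: M_def\<close>)
  qed
  \<comment> \<open>If \<open>f \<otimes> l\<close> stays in \<open>F\<close> for all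
    \<open>l \<in> L\<close>, then the part \<open>A\<close> puts \<open>f\<close> into
    \<open>F'\<close>, while \<open>L1\<close> and its products with \<open>A\<close> put all
    \<open>f \<otimes> inv e \<otimes> m\<close> into \<open>F'\<close>.\<close>
  define L1 where "L1 = (\<lambda>(e, m). inv e \<otimes> m) ` (E \<times> M)"
  define L where "L = A \<union> L1 \<union> (\<lambda>(l, a). l \<otimes> a) ` (L1 \<times> A)"
  have L1: "finite L1" "L1 \<subseteq> carrier G" using E M by (auto simp: L1_def subset_iff)
  then have L: "finite L" "L \<subseteq> carrier G" "L \<noteq> {}"
    using A_fin A_sub A_ne by (auto simp: L_def)
  have cL: "0 < real (card L)" using L by (simp add: card_gt_0_iff)
  define c where "c = ln (real (card A))"
  have c: "0 \<le> c" using card_A_ge_1 by (simp add: c_def)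
  \<comment> \<open>Keeps the boundary cost \<open>card L * \<delta> * c\<close> below \<eta>;
    \<open>c + 1\<close> guards against a one-letter alphabet.\<close>
  define \<delta> where "\<delta> = \<eta> / (card L * (c + 1))"
  have \<delta>: "0 < \<delta>" using \<eta> c cL by (simp add: \<delta>_def)
  have "card L * \<delta> * c = \<eta> * (c / (c + 1))" using cL by (simp add: \<delta>_def)
  also have "\<dots> \<le> \<eta> * 1" using \<eta> c by (intro mult_left_mono) auto
  finally have \<delta>c: "card L * \<delta> * c \<le> \<eta>" by simp
  obtain F where "F \<in> right_invariant_sets G L \<delta>"
    using \<open>amenable G\<close> L \<delta> unfolding amenable_def by blast
  then have F: "finite F" "F \<noteq> {}" "F \<subseteq> carrier G" and
      inv: "real (card (sym_diff (F <#> L) F)) < \<delta> * real (card F)"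
    by (auto simp: right_invariant_sets_def)
  have cF: "0 < real (card F)" using F by (simp add: card_gt_0_iff)
  define F' where "F' = {s\<in>F. \<forall>a\<in>A. s \<otimes> a \<in> F}"
  have F'F: "F' \<subseteq> F" by (auto simp: F'_def)
  then have F': "finite F'" "F' \<subseteq> carrier G" using F finite_subset by auto
  obtain Y where Y: "Y \<subseteq> F' \<rightarrow>\<^sub>E A" "\<And>y. y \<in> Y \<Longrightarrow> locally_bijective y F'"
    "(card A / exp 1) ^ card F \<le> card Y * real (card A) ^ card (F - F')"
    using many_locally_bijective_patterns[OF F(1,3), folded F'_def] by blast
  define G0 where "G0 = {g\<in>F'. \<forall>m\<in>M. g \<otimes> m \<in> F'}"
  have G0: "finite G0" "G0 \<subseteq> carrier G" using F' by (auto simp: G0_def)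
  have "card G0 \<le> card F" using F F'F by (intro card_mono) (auto simp: G0_def)
  define P where "P = {f\<in>F'. \<forall>e\<in>E. f \<otimes> inv e \<in> G0}"
  have tiling: "card Y ^ card E \<le> card (patterns E) ^ card G0 * (card A ^ card (F' - P)) ^ card E"
    unfolding P_def
  proof (rule pattern_count_tiling[OF F' E G0 Y(1)])
    fix g assume g: "g \<in> G0"
    then have gc: "g \<in> carrier G" using G0 by auto
    let ?gE = "(\<lambda>e. g \<otimes> e) ` E"
    have sub: "g \<otimes> m \<in> F'" if "m \<in> M" for m using g that by (auto simp: G0_def)
    then have gE: "?gE \<inter> F' = ?gE" using M(2) by auto
    let ?t = "\<lambda>p. \<lambda>t\<in>?gE. p (inv g \<otimes> t)"
    have "(\<lambda>y. restrict y (?gE \<inter> F')) ` Y \<subseteq> ?t ` patterns E"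
    proof
      fix w assume "w \<in> (\<lambda>y. restrict y (?gE \<inter> F')) ` Y"
      then obtain y where y: "y \<in> Y" "w = restrict y ?gE" by (auto simp: gE)
      obtain a where a: "a \<in> A" using A_ne by auto
      \<comment> \<open>The pattern \<open>y\<close> pulled back by \<open>g\<close> and padded with
        a fixed letter; local bijectivity on \<open>M\<close> never sees the padding.\<close>
      define x where "x = (\<lambda>t\<in>carrier G. if g \<otimes> t \<in> F' then y (g \<otimes> t) else a)"
      have yA: "y t \<in> A" if "t \<in> F'" for t using Y(1) y(1) that by auto
      have xA: "x \<in> carrier G \<rightarrow>\<^sub>E A" using a yA by (auto simp: x_def)
      let ?gM = "(\<lambda>m. g \<otimes> m) ` M"
      have lok: "locally_bijective y ?gM"
        by (rule locally_bijective_mono[OF Y(2)[OF y(1)]]) (use sub F' yA in auto)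
      have xm: "x m = y (g \<otimes> m)" if "m \<in> M" for m
        using that sub M(3) by (auto simp: x_def)
      have xmc: "x m \<in> carrier G" "m \<in> carrier G" if "m \<in> M" for m
        using that M(3) xA A_sub by blast+
      have eq: "g \<otimes> m \<otimes> y (g \<otimes> m) = g \<otimes> (m \<otimes> x m)" if "m \<in> M" for m
        using xm[OF that] xmc[OF that] gc by (simp add: m_assoc)
      have "locally_bijective x M"
        unfolding locally_bijective_def
      proof (intro conjI ballI impI)
        show "inj_on (\<lambda>s. s \<otimes> x s) M"
        proof (rule inj_onI)
          fix m n assume mn: "m \<in> M" "n \<in> M" "m \<otimes> x m = n \<otimes> x n"
          then have "g \<otimes> m \<otimes> y (g \<otimes> m) = g \<otimes> n \<otimes> y (g \<otimes> n)" by (simp add: eq)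
          moreover have "inj_on (\<lambda>s. s \<otimes> y s) ?gM" using lok by (simp only: locally_bijective_def)
          ultimately have "g \<otimes> m = g \<otimes> n" using mn by (auto dest: inj_onD)
          then show "m = n" using gc xmc mn by simp
        qed
        fix t assume t: "t \<in> carrier G" "(\<lambda>a. t \<otimes> inv a) ` A \<subseteq> M"
        have "(\<lambda>a. (g \<otimes> t) \<otimes> inv a) ` A \<subseteq> ?gM"
        proof safe
          fix a assume a: "a \<in> A"
          then have "(g \<otimes> t) \<otimes> inv a = g \<otimes> (t \<otimes> inv a)" using gc t(1) A_sub by (simp add: m_assoc subset_iff)
          then show "(g \<otimes> t) \<otimes> inv a \<in> ?gM" using t(2) a by blast
        qed
        then have "g \<otimes> t \<in> (\<lambda>s. s \<otimes> y s) ` ?gM"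
          using lok gc t(1) by (simp add: locally_bijective_def)
        then obtain m where m: "m \<in> M" "g \<otimes> t = g \<otimes> (m \<otimes> x m)" using eq by auto
        then have "t = m \<otimes> x m" using gc t(1) xmc[OF m(1)] by simp
        then show "t \<in> (\<lambda>s. s \<otimes> x s) ` M" using m(1) by blast
      qed
      then have "restrict x E \<in> patterns E" using extends xA by blast
      moreover have "w = ?t (restrict x E)"
      proof
        fix t
        show "w t = ?t (restrict x E) t"
        proof (cases "t \<in> ?gE")
          case True
          then obtain e where e: "e \<in> E" "t = g \<otimes> e" by auto
          moreover have "inv g \<otimes> (g \<otimes> e) = e" using e E gc by (auto simp: subset_iff simp flip: m_assoc)
          ultimately show ?thesis using True xm[of e] M(2) by (auto simp: y(2))
        qed (simp add: y(2))
      qed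
      ultimately show "w \<in> ?t ` patterns E" by blast
    qed
    then show "card ((\<lambda>y. restrict y (?gE \<inter> F')) ` Y) \<le> card (patterns E)"
      using finite_patterns[OF E(1,3)] by (rule surj_card_le[rotated])
  qed
  have "F - P \<subseteq> {f\<in>F. \<exists>l\<in>L. f \<otimes> l \<notin> F}"
  proof (rule subsetI, rule ccontr)
    fix f assume f: "f \<in> F - P" and "f \<notin> {f\<in>F. \<exists>l\<in>L. f \<otimes> l \<notin> F}"
    then have fL: "f \<otimes> l \<in> F" if "l \<in> L" for l using that by auto
    have fc: "f \<in> carrier G" using f F by auto
    have inF': "f \<otimes> inv e \<otimes> m \<in> F'" if em: "e \<in> E" "m \<in> M" for e m
    proof -
      have l: "inv e \<otimes> m \<in> L1" using em by (auto simp: L1_def)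
      have emc: "e \<in> carrier G" "m \<in> carrier G" using em E M by auto
      have "f \<otimes> (inv e \<otimes> m) \<in> F" using l by (intro fL) (simp add: L_def)
      then have 1: "f \<otimes> inv e \<otimes> m \<in> F" using emc fc by (simp add: m_assoc)
      have "f \<otimes> inv e \<otimes> m \<otimes> a \<in> F" if a: "a \<in> A" for a
      proof -
        have "a \<in> carrier G" using a A_sub by auto
        have "f \<otimes> (inv e \<otimes> m \<otimes> a) \<in> F" using l a by (intro fL) (auto simp: L_def)
        then show ?thesis using emc fc \<open>a \<in> carrier G\<close> by (simp add: m_assoc)
      qed
      then show ?thesis using 1 by (simp add: F'_def)
    qed
    have "f \<otimes> inv e \<in> G0" if e: "e \<in> E" for e
    proof -
      have "f \<otimes> inv e \<in> F'" using inF'[OF e M(4)] fc e E by (auto simp: subset_iff)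
      then show ?thesis using inF'[OF e] by (simp add: G0_def)
    qed
    moreover have "f \<in> F'" using fL f by (auto simp: F'_def L_def)
    ultimately show False using f by (simp add: P_def)
  qed
  then have "card (F - P) \<le> card {f\<in>F. \<exists>l\<in>L. f \<otimes> l \<notin> F}" using F by (intro card_mono) auto
  also have "\<dots> \<le> card L * card (sym_diff (F <#> L) F)" by (rule card_right_boundary_le[OF F(1,3) L(1,2)])
  finally have "real (card (F - P)) \<le> card L * real (card (sym_diff (F <#> L) F))"
    by (simp flip: of_nat_mult)
  also have "\<dots> \<le> card L * (\<delta> * card F)" using inv cL by (intro mult_left_mono) auto
  finally have bdry: "real (card (F - P)) \<le> card L * \<delta> * card F" by (simp add: mult.assoc)
  \<comment> \<open>The loss from \<open>F\<close> to \<open>F'\<close> in the permanent bound and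
    the loss from \<open>F'\<close> to \<open>P\<close> in the covering add up to a single boundary
    term.\<close>
  have split: "card (F - P) = card (F - F') + card (F' - P)"
  proof -
    have "P \<subseteq> F'" by (auto simp: P_def)
    then have "F - P = (F - F') \<union> (F' - P)" using F'F by blast
    moreover have "card ((F - F') \<union> (F' - P)) = card (F - F') + card (F' - P)"
      using F F' by (intro card_Un_disjoint) auto
    ultimately show ?thesis by simp
  qed
  have A1: "1 \<le> real (card A)" using card_A_ge_1 by simp
  have N1: "1 \<le> real (card (patterns E))" using card_patterns_ge_1[OF E(1,3)] by simp
  have "0 < (card A / exp 1) ^ card F" using A1 by simp
  then have Ypos: "0 < real (card Y)" using Y(3) by (metis linorder_not_less mult_eq_0_iff of_nat_0_le_iff order_le_less)
  have "ln ((card A / exp 1) ^ card F) \<le> ln (card Y * real (card A) ^ card (F - F'))"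
    using A1 Y(3) by (intro ln_mono) auto
  then have s1: "card F * ln (card A / exp 1) \<le> ln (card Y) + card (F - F') * c"
    using Ypos A1 by (simp add: ln_mult ln_realpow c_def)
  have "real (card Y) ^ card E \<le> real (card (patterns E)) ^ card G0 * (real (card A) ^ card (F' - P)) ^ card E"
    using tiling by (simp flip: of_nat_power of_nat_mult)
  also have "\<dots> \<le> real (card (patterns E)) ^ card F * (real (card A) ^ card (F' - P)) ^ card E"
    using N1 \<open>card G0 \<le> card F\<close> by (intro mult_right_mono power_increasing) auto
  finally have "ln (real (card Y) ^ card E)
      \<le> ln (real (card (patterns E)) ^ card F * (real (card A) ^ card (F' - P)) ^ card E)"
    using Ypos by (intro ln_mono) auto
  then have s2: "card E * ln (card Y) \<le> card F * ln (card (patterns E)) + card E * (card (F' - P) * c)"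
    using Ypos A1 N1 by (simp add: ln_mult ln_realpow c_def)
  have cE: "0 < real (card E)" using E by (simp add: card_gt_0_iff)
  have "ln (card Y) \<le> (card F * ln (card (patterns E)) + card E * (card (F' - P) * c)) / card E"
    using s2 cE by (simp add: pos_le_divide_eq mult.commute)
  also have "\<dots> = card F * (ln (card (patterns E)) / card E) + card (F' - P) * c"
    using cE by (simp add: add_divide_distrib)
  finally have "card F * ln (card A / exp 1)
      \<le> card F * (ln (card (patterns E)) / card E) + real (card (F - P)) * c"
    using s1 by (simp add: split distrib_right)
  also have "real (card (F - P)) * c \<le> card L * \<delta> * card F * c"
    using bdry c by (rule mult_right_mono)
  also have "\<dots> = card F * (card L * \<delta> * c)" by simp
  also have "\<dots> \<le> card F * \<eta>" using \<delta>c by (intro mult_left_mono) auto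
  finally have "card F * ln (card A / exp 1) \<le> card F * (ln (card (patterns E)) / card E + \<eta>)"
    by (simp add: distrib_left)
  then show "ln (card A / exp 1) \<le> ln (card (patterns E)) / card E + \<eta>" using cF by simp
qed


subsection \<open>Vanishing entropy\<close>

lemma card_patterns_le:
  assumes "finite E" "E \<subseteq> carrier G"
  shows "card (patterns E) \<le> card A ^ card E"
  using card_mono[OF _ patterns_PiE[OF assms(2)]] assms A_fin by (simp add: finite_PiE card_PiE)

lemma entropy_rate_singleton:
  assumes "card A = 1"
  shows "entropy_rate = 0"
proof -
  have "card (patterns {\<one>}) = 1"
    using card_patterns_le[of "{\<one>}"] card_patterns_ge_1[of "{\<one>}"] assms by simp
  then show ?thesis
    using entropy_rate_le[of "{\<one>}"] entropy_rate_nonneg by simp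
qed

text \<open>Put \<open>c = a \<otimes> inv b\<close>. The point \<open>s \<otimes> a\<close> can be
  hit only from \<open>s\<close> by \<open>a\<close> or from \<open>s \<otimes> c\<close> by
  \<open>b\<close>. If \<open>x s = a\<close>, injectivity forbids \<open>b\<close> at
  \<open>s \<otimes> c\<close>; if \<open>x s = b\<close>, surjectivity forces \<open>b\<close>
  there.\<close>

lemma two_letters_constant:
  assumes A: "A = {a, b}" "a \<noteq> b" and x: "x \<in> X" and s: "s \<in> carrier G"
  shows "x (s \<otimes> (a \<otimes> inv b)) = x s"
proof -
  let ?c = "a \<otimes> inv b"
  have ab: "a \<in> carrier G" "b \<in> carrier G" using A A_sub by auto
  have cb: "s \<otimes> ?c \<otimes> b = s \<otimes> a" using ab s by (simp add: m_assoc)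
  have inj: "inj_on (\<lambda>s. s \<otimes> x s) (carrier G)" and surj: "(\<lambda>s. s \<otimes> x s) ` carrier G = carrier G"
    using x by (auto simp: restricted_permutations_def bij_betw_def)
  have xA: "x t = a \<or> x t = b" if "t \<in> carrier G" for t using X_in[OF x that] A by auto
  have sc: "s \<otimes> ?c \<in> carrier G" using ab s by simp
  have "s \<otimes> a \<in> (\<lambda>s. s \<otimes> x s) ` carrier G" using ab s surj by simp
  then obtain r where r: "r \<in> carrier G" "r \<otimes> x r = s \<otimes> a" by (metis imageE)
  have r': "r = s \<or> r = s \<otimes> ?c"
  proof (cases "x r = a")
    case True
    then show ?thesis using r s ab by simp
  next
    case False
    then have "r \<otimes> b = s \<otimes> ?c \<otimes> b" using r xA[OF r(1)] cb by simp
    then have "r = s \<otimes> ?c" using right_cancel[of b r "s \<otimes> ?c"] r(1) ab sc by blast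
    then show ?thesis ..
  qed
  have ne: "s \<noteq> s \<otimes> ?c"
  proof
    assume "s = s \<otimes> ?c"
    then have "s \<otimes> b = s \<otimes> a" using cb by simp
    then show False using ab s A by simp
  qed
  show ?thesis
  proof (cases "x s = a")
    case True
    have "x (s \<otimes> ?c) \<noteq> b"
    proof
      assume "x (s \<otimes> ?c) = b"
      then have "s \<otimes> x s = (s \<otimes> ?c) \<otimes> x (s \<otimes> ?c)" using True cb by simp
      then show False using inj_onD[OF inj _ s sc] ne by simp
    qed
    then show ?thesis using True xA[OF sc] by simp
  next
    case False
    then have xb: "x s = b" using xA[OF s] by simp
    then have "r \<noteq> s" using r ab s A by auto
    then have "r = s \<otimes> ?c" using r' by simp
    then have "s \<otimes> ?c \<otimes> x (s \<otimes> ?c) = s \<otimes> ?c \<otimes> b" using r cb by simp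
    moreover have "x (s \<otimes> ?c) \<in> carrier G" using X_in[OF x sc] A_sub by auto
    ultimately show ?thesis using xb sc ab by simp
  qed
qed

text \<open>A window of \<open>m\<close> distinct powers of \<open>a \<otimes> inv b\<close> carries
  only constant patterns, at most two of them, so the rate is at most \<open>ln 2 / m\<close> for
  every \<open>m\<close>. The value 0 of \<open>ord\<close> encodes infinite order.\<close>

lemma entropy_rate_infinite_order:
  assumes A: "A = {a, b}" "a \<noteq> b" and ord: "ord (a \<otimes> inv b) = 0"
  shows "entropy_rate = 0"
proof (rule ccontr)
  assume "entropy_rate \<noteq> 0"
  then have h: "entropy_rate > 0" using entropy_rate_nonneg by simp
  let ?c = "a \<otimes> inv b"
  have c: "?c \<in> carrier G" using A A_sub by auto
  have inj: "m = n" if "?c [^] (m::nat) = ?c [^] n" for m n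
    using that infinite_cyclic_subgroup[OF c] infinite_cyclic_subgroup_order[OF c] ord by blast
  obtain n where n: "ln 2 / entropy_rate < real n" using reals_Archimedean2 by blast
  define m where "m = Suc n"
  have m: "ln 2 < entropy_rate * real m" using n h by (simp add: m_def field_simps)
  define E where "E = (\<lambda>i::nat. ?c [^] i) ` {..<m}"
  have E: "finite E" "E \<noteq> {}" "E \<subseteq> carrier G" using c by (auto simp: E_def m_def)
  have "card E = m" unfolding E_def using inj by (subst card_image) (auto intro!: inj_onI)
  have const: "x (?c [^] i) = x \<one>" if x: "x \<in> X" for x and i :: nat
    using two_letters_constant[OF A x] c by (induction i) simp_all
  have "patterns E \<subseteq> (\<lambda>v. \<lambda>t\<in>E. v) ` A"
  proof
    fix p assume "p \<in> patterns E"
    then obtain x where x: "x \<in> X" "p = restrict x E" by (auto simp: patterns_def)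
    have "x t = x \<one>" if "t \<in> E" for t using that const[OF x(1)] by (auto simp: E_def)
    then have "p = (\<lambda>t\<in>E. x \<one>)" using x(2) by (auto simp: restrict_def)
    then show "p \<in> (\<lambda>v. \<lambda>t\<in>E. v) ` A" using X_in[OF x(1)] by auto
  qed
  then have "card (patterns E) \<le> card A" using A_fin by (rule surj_card_le[rotated])
  then have "ln (real (card (patterns E))) \<le> ln 2"
    using A card_patterns_ge_1[OF E(1,3)] by (intro ln_mono) auto
  then have "ln (real (card (patterns E))) / card E \<le> ln 2 / card E" by (rule divide_right_mono) simp
  then have "entropy_rate \<le> ln 2 / m" using entropy_rate_le[OF E] \<open>card E = m\<close> by simp
  then show False using m by (simp add: m_def field_simps)
qed

text \<open>Letters can be chosen freely, one per left coset of the finite subgroup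
  \<open>H\<close>. A window \<open>E\<close> meets at least \<open>card E / card H\<close> cosets
  and so admits that many independent binary choices.\<close>

lemma entropy_rate_finite_order:
  assumes A: "A = {a, b}" "a \<noteq> b" and ord: "ord (a \<otimes> inv b) \<noteq> 0"
  shows "0 < entropy_rate"
proof -
  let ?c = "a \<otimes> inv b"
  have ab: "a \<in> carrier G" "b \<in> carrier G" using A A_sub by auto
  have c: "?c \<in> carrier G" using ab by simp
  define H where "H = generate G {?c}"
  have finH: "finite H"
    using finite_cyclic_subgroup_order[OF c] ord c by (simp add: H_def carrier_subgroup_generated)
  have subH: "subgroup H G" unfolding H_def using c by (intro generate_is_subgroup) auto
  interpret H: subgroup H G by (rule subH)
  have cH: "?c \<in> H" unfolding H_def by (rule generate.incl) simp
  have cardH: "0 < card H" using finH cH by (auto simp: card_gt_0_iff)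
  define coset where "coset s = (\<lambda>h. s \<otimes> h) ` H" for s
  have coset_c: "coset (s \<otimes> ?c) = coset s" if s: "s \<in> carrier G" for s
  proof -
    have "(\<lambda>h. ?c \<otimes> h) ` H = H"
    proof (intro equalityI subsetI)
      fix h assume h: "h \<in> H"
      then have "h = ?c \<otimes> (inv ?c \<otimes> h)" using c by (simp flip: m_assoc)
      then show "h \<in> (\<lambda>h. ?c \<otimes> h) ` H" using h cH by blast
    qed (use cH in blast)
    then have "coset s = (\<lambda>h. s \<otimes> h) ` (\<lambda>h. ?c \<otimes> h) ` H" by (simp add: coset_def)
    also have "\<dots> = coset (s \<otimes> ?c)"
      unfolding coset_def image_image using s c by (intro image_cong) (auto simp: m_assoc[OF s c])
    finally show ?thesis by simp
  qed
  have self: "s \<in> coset s" if "s \<in> carrier G" for s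
    unfolding coset_def using that by (intro image_eqI[of _ _ \<one>]) auto
  define x where "x V = (\<lambda>s\<in>carrier G. if coset s \<in> V then a else b)" for V
  have xX: "x V \<in> X" for V
  proof -
    \<comment> \<open>The preimage of \<open>t\<close> is \<open>t \<otimes> inv a\<close> or
      \<open>t \<otimes> inv b\<close>; both lie in the same coset, since they differ by
      \<open>?c\<close> on the right, and this coset decides between them.\<close>
    let ?g = "\<lambda>t. if coset (t \<otimes> inv b) \<in> V then t \<otimes> inv a else t \<otimes> inv b"
    have 1: "coset (t \<otimes> inv a) = coset (t \<otimes> inv b)" if "t \<in> carrier G" for t
    proof -
      have "inv a \<otimes> ?c = inv b" using ab by (simp flip: m_assoc)
      then have "t \<otimes> inv a \<otimes> ?c = t \<otimes> inv b" using that ab by (simp add: m_assoc)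
      then show ?thesis using coset_c[of "t \<otimes> inv a"] that ab by simp
    qed
    have 2: "coset (s \<otimes> a \<otimes> inv b) = coset s" if "s \<in> carrier G" for s
      using coset_c[OF that] that ab by (simp add: m_assoc)
    have 3: "t \<otimes> v \<otimes> inv v = t" "t \<otimes> inv v \<otimes> v = t" if "t \<in> carrier G" "v \<in> carrier G" for t v
      using that by (simp_all add: m_assoc)
    have "bij_betw (\<lambda>s. s \<otimes> x V s) (carrier G) (carrier G)"
      by (rule bij_betw_byWitness[where f' = ?g]) (use ab in \<open>auto simp: x_def 1 2 3\<close>)
    then show ?thesis using A by (simp add: restricted_permutations_def x_def)
  qed
  have "ln 2 / card H \<le> ln (card (patterns E)) / card E" if E: "finite E" "E \<noteq> {}" "E \<subseteq> carrier G" for E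
  proof -
    let ?Q = "coset ` E"
    have "inj_on (\<lambda>V. restrict (x V) E) (Pow ?Q)"
    proof (rule inj_on_inverseI)
      fix V assume V: "V \<in> Pow ?Q"
      \<comment> \<open>The cosets of the points labelled \<open>a\<close> recover \<open>V\<close>,
        so distinct \<open>V\<close> give distinct patterns.\<close>
      show "coset ` {s\<in>E. restrict (x V) E s = a} = V"
        using V E(3) A(2) by (auto simp: x_def subset_iff split: if_splits)
    qed
    moreover have "(\<lambda>V. restrict (x V) E) ` Pow ?Q \<subseteq> patterns E" using xX by (auto simp: patterns_def)
    ultimately have "card (Pow ?Q) \<le> card (patterns E)"
      using finite_patterns[OF E(1,3)] by (rule card_inj_on_le)
    then have pow: "2 ^ card ?Q \<le> card (patterns E)" using E by (simp add: card_Pow)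
    have "E \<subseteq> \<Union>?Q" using self E by blast
    moreover have finQ: "finite (\<Union>?Q)" using E finH by (auto simp: coset_def)
    ultimately have "card E \<le> card (\<Union>?Q)" by (intro card_mono)
    also have "\<dots> \<le> (\<Sum>q\<in>?Q. card q)" by (rule card_Union_le_sum_card)
    also have "\<dots> \<le> (\<Sum>q\<in>?Q. card H)"
      using finH by (intro sum_mono) (auto simp: coset_def intro: card_image_le)
    finally have "card E \<le> card ?Q * card H" by simp
    then have cE: "real (card E) \<le> card ?Q * real (card H)" by (simp flip: of_nat_mult)
    have "real (2 ^ card ?Q) \<le> real (card (patterns E))" using pow by (simp only: of_nat_le_iff)
    then have "ln (real (2 ^ card ?Q)) \<le> ln (real (card (patterns E)))" by (intro ln_mono) auto
    then have Q: "card ?Q * ln 2 \<le> ln (real (card (patterns E)))" by (simp add: ln_realpow)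
    have "ln 2 * card E \<le> ln 2 * (card ?Q * real (card H))" using cE by (intro mult_left_mono) auto
    also have "\<dots> = (card ?Q * ln 2) * card H" by simp
    also have "\<dots> \<le> ln (real (card (patterns E))) * card H" using Q by (intro mult_right_mono) auto
    finally show ?thesis using cardH E by (simp add: card_gt_0_iff field_simps)
  qed
  then have "ln 2 / card H \<le> entropy_rate" by (intro entropy_rate_ge) auto
  moreover have "0 < ln 2 / real (card H)" using cardH by simp
  ultimately show ?thesis by linarith
qed

end

theorem corollary7p5:
  fixes G :: "('g, 'm) monoid_scheme" and A :: "'g set"
  assumes "group G"
    and "countable (carrier G)" and "infinite (carrier G)"
    and "amenable G"
    and "A \<subseteq> carrier G" and "finite A" and "A \<noteq> {}"
  shows "h_top G A \<ge> ereal (ln (real (card A) / exp 1)) \<and>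
    (h_top G A = 0 \<longleftrightarrow>
      card A = 1 \<or>
      (card A = 2 \<and> (\<exists>s t. A = {s, t} \<and> group.ord G (s \<otimes>\<^bsub>G\<^esub> inv\<^bsub>G\<^esub> t) = 0)))"
proof -
  interpret finite_alphabet G A
    using assms by (simp add: finite_alphabet_def finite_alphabet_axioms_def)
  have bound: "ln (card A / exp 1) \<le> entropy_rate"
    using ln_div_exp_le_pattern_entropy[OF \<open>amenable G\<close>] by (rule entropy_rate_ge)
  have "entropy_rate = 0 \<longleftrightarrow> card A = 1 \<or>
      (card A = 2 \<and> (\<exists>s t. A = {s, t} \<and> ord (s \<otimes>\<^bsub>G\<^esub> inv\<^bsub>G\<^esub> t) = 0))"
  proof
    assume h0: "entropy_rate = 0"
    have "card A \<le> 2"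
    proof (rule ccontr)
      assume "\<not> card A \<le> 2"
      then have "3 \<le> real (card A)" by simp
      then have "exp 1 < real (card A)" using e_less_272 by simp
      then have "0 < ln (card A / exp 1)" by (intro ln_gt_zero) (simp add: field_simps)
      then show False using bound h0 by simp
    qed
    then consider "card A = 1" | "card A = 2" using card_A_ge_1 by linarith
    then show "card A = 1 \<or> (card A = 2 \<and> (\<exists>s t. A = {s, t} \<and> ord (s \<otimes>\<^bsub>G\<^esub> inv\<^bsub>G\<^esub> t) = 0))"
    proof cases
      case 2
      then obtain s t where "A = {s, t}" "s \<noteq> t" by (auto simp: card_2_iff)
      then show ?thesis using 2 entropy_rate_finite_order[of s t] h0 by auto
    qed simp
  next
    assume "card A = 1 \<or> (card A = 2 \<and> (\<exists>s t. A = {s, t} \<and> ord (s \<otimes>\<^bsub>G\<^esub> inv\<^bsub>G\<^esub> t) = 0))"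
    then show "entropy_rate = 0"
    proof (elim disjE conjE exE)
      fix s t assume st: "card A = 2" "A = {s, t}" "ord (s \<otimes>\<^bsub>G\<^esub> inv\<^bsub>G\<^esub> t) = 0"
      then have "s \<noteq> t" by auto
      then show ?thesis using entropy_rate_infinite_order st by blast
    qed (rule entropy_rate_singleton)
  qed
  then show ?thesis
    using bound by (simp add: h_top_eq_entropy_rate[OF \<open>amenable G\<close>])
qed

end
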